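(* Let $m\in\mathbb{N}$, let $h:\mathbb{N}^m\to\mathbb{N}$ be a polynomial having no constant term, and let $p_1,\ldots,p_m$ be minimal idempotents in $(\beta\mathbb{N},+)$. Then for every $A\in\tilde h\left(\bigotimes_{i=1}^m p_i\right)$ and every $T\in\mathcal{P}_f(\mathbb{P})$ there exist functions $\alpha_1,\ldots,\alpha_m:\mathcal{P}_f(\mathbb{N}^{\mathbb{N}})\to\mathbb{N}$ and $H_1,\ldots,H_m:\mathcal{P}_f(\mathbb{N}^{\mathbb{N}})\to\mathcal{P}_f(\mathbb{N})$ such that (1) if $G,K\in\mathcal{P}_f(\mathbb{N}^{\mathbb{N}})$ and $G\subsetneq K$, then $H_i(G)<H_i(K)$ for each $i\in\{1,\ldots,m\}$; (2) if $G_1\subsetneq G_2\subsetneq\cdots\subsetneq G_n\subsetneq\cdots$ is an infinite sequence in $\mathcal{P}_f(\mathbb{N}^{\mathbb{N}})$, then for all $\beta_1<\beta_2<\cdots<\beta_m$ in $\mathcal{P}_f(\mathbb{N})$, all $f_i\in G_i$ ($i\in\mathbb{N}$), and all $P_1,\ldots,P_m\in T$, $$h\left(\sum_{i\in\beta_1}\alpha_1(G_i)+P_1\Bigl(\sum_{i\in\beta_1}\sum_{t\in H_1(G_i)}f_i(t)\Bigr),\ldots,\sum_{i\in\beta_m}\alpha_m(G_i)+P_m\Bigl(\sum_{i\in\beta_m}\sum_{t\in H_m(G_i)}f_i(t)\Bigr)\right)\in A;$$ (3) if there is a minimal idempotent $p$ with $p_i=p$ for each $i\in\{1,\ldots,m\}$,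 then the functions can be chosen so that $\alpha_i=\alpha$ and $H_i=H$ for all $i$, for some functions $\alpha:\mathcal{P}_f(\mathbb{N}^{\mathbb{N}})\to\mathbb{N}$ and $H:\mathcal{P}_f(\mathbb{N}^{\mathbb{N}})\to\mathcal{P}_f(\mathbb{N})$. In fact, the same holds for idempotents of $(\mathcal{J}_p,+)$ in place of minimal idempotents.
   Context: $\mathbb{N}$ is the set of positive integers; $\mathcal{P}_f(X)$ is the set of nonempty finite subsets of $X$; $\mathbb{N}^{\mathbb{N}}$ is the set of all functions $\mathbb{N}\to\mathbb{N}$. For $\beta,\gamma\in\mathcal{P}_f(\mathbb{N})$, $\beta<\gamma$ means $\max\beta<\min\gamma$. $\mathbb{P}$ is the set of one-variable polynomials with integer coefficients and zero constant term. $\beta X$ denotes the set of ultrafilters on a discrete set $X$ (Stone–Čech compactification). On $\beta\mathbb{N}$: $A\in p+q$ iff $\{x\in\mathbb{N}:-x+A\in q\}\in p$, where $-x+A=\{y\in\mathbb{N}:x+y\in A\}$. An ultrafilter $p$ is idempotent if $p+p=p$; a minimal idempotent is an idempotent lying in $K(\beta\mathbb{N},+)$, the smallest two-sided ideal (the union of all minimal left ideals) of $(\beta\mathbb{N},+)$. For a map $h:\mathbb{N}^m\to\mathbb{N}$, $\tilde h:\beta(\mathbb{N}^m)\to\beta\mathbb{N}$ is its continuous extension: $A\in\tilde h(u)$ iff $h^{-1}(A)\in u$. Since $h$ is defined on $\mathbb{N}^m$, writing $h(u_1,\ldots,u_m)\in A$ includes that $u_1,\ldots,u_m\in\mathbb{N}$.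 A set $A\subseteq\mathbb{N}$ is a $J_p$-set if for every $F\in\mathcal{P}_f(\mathbb{P})$ and every $H\in\mathcal{P}_f(\mathbb{N}^{\mathbb{N}})$ there exist $a\in\mathbb{N}$ and $\beta\in\mathcal{P}_f(\mathbb{N})$ such that $a+P(\sum_{t\in\beta}f(t))\in A$ for all $P\in F$ and $f\in H$. $\mathcal{J}_p=\{q\in\beta\mathbb{N}:\text{every }A\in q\text{ is a }J_p\text{-set}\}$ (the subscript $p$ stands for "polynomial" and is not an ultrafilter); it is a two-sided ideal of $(\beta\mathbb{N},+)$. Tensor products: for ultrafilters $p_1,\ldots,p_k$ on $\mathbb{N}$, $\bigotimes_{i=1}^k p_i$ is the ultrafilter on $\mathbb{N}^k$ defined recursively by $\bigotimes_{i=1}^1p_i=p_1$, and, for $A\subseteq\mathbb{N}^{k+1}$, $A\in\bigotimes_{i=1}^{k+1}p_i$ iff $\{(x_1,\ldots,x_k)\in\mathbb{N}^k:\{x_{k+1}\in\mathbb{N}:(x_1,\ldots,x_{k+1})\in A\}\in p_{k+1}\}\in\bigotimes_{i=1}^kp_i$. *)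

theory Defs
  imports Complex_Main "HOL-Library.FuncSet" "HOL-Library.Poly_Mapping"
    "HOL-Computational_Algebra.Polynomial"
begin

section \<open>Positive integers, finite sets, polynomials\<close>

abbreviation Npos :: "nat set" where
  "Npos \<equiv> {0<..}"

text \<open>Extensional functions, so that equality in this set is equality of functions on
  the positive integers.\<close>

abbreviation NN :: "(nat \<Rightarrow> nat) set" where
  "NN \<equiv> Npos \<rightarrow>\<^sub>E Npos"

definition Pf :: "'a set \<Rightarrow> 'a set set" where
  "Pf X = Fpow X - {{}}"

definition precedes :: "nat set \<Rightarrow> nat set \<Rightarrow> bool"  (infix "\<lless>" 50) where
  "B \<lless> C \<longleftrightarrow> Max B < Min C"

definition PP :: "int poly set" where
  "PP = {P. coeff P 0 = 0}"

text \<open>The \<open>m\<close>-tuple \<open>(x\<^sub>1, \<dots>, x\<^sub>m)\<close> is the list \<open>[x\<^sub>1, \<dots>, x\<^sub>m]\<close>.\<close>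

definition tuples :: "nat \<Rightarrow> nat list set" where
  "tuples m = {x. length x = m \<and> set x \<subseteq> Npos}"

text \<open>Multivariate polynomials are finitely supported maps from monomials (exponent vectors)
  to coefficients; the monomial \<open>0\<close> is the constant one, and the variables are numbered from
  \<open>0\<close> to \<open>m - 1\<close>. Real coefficients are allowed: all that is asked is that the function takes
  positive integers to positive integers.\<close>

definition polynomial_map_no_const :: "nat \<Rightarrow> (nat list \<Rightarrow> nat) \<Rightarrow> bool" where
  "polynomial_map_no_const m h \<longleftrightarrow>
     h \<in> tuples m \<rightarrow> Npos \<and>
     (\<exists>q :: (nat \<Rightarrow>\<^sub>0 nat) \<Rightarrow>\<^sub>0 real.
        Poly_Mapping.lookup q 0 = 0 \<and>
        (\<forall>\<mu>\<in>Poly_Mapping.keys q. Poly_Mapping.keys \<mu> \<subseteq> {..<m}) \<and>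
        (\<forall>x\<in>tuples m. real (h x) =
           (\<Sum>\<mu>\<in>Poly_Mapping.keys q.
              Poly_Mapping.lookup q \<mu> * (\<Prod>i<m. real (x ! i) ^ Poly_Mapping.lookup \<mu> i))))"


section \<open>Ultrafilters\<close>

text \<open>Ultrafilters on \<open>X\<close>, as ultrafilters on the ambient type that contain \<open>X\<close>.
  The set \<open>A\<close> is a member of \<open>p\<close> iff \<open>\<forall>\<^sub>F x in p. x \<in> A\<close>, and the continuous extension
  of a map \<open>h\<close> is \<open>filtermap h\<close>.\<close>

definition beta :: "'a set \<Rightarrow> 'a filter set" where
  "beta X = {p. p \<noteq> bot \<and> p \<le> principal X \<and>
                (\<forall>P. eventually P p \<or> eventually (\<lambda>x. \<not> P x) p)}"

definition filter_bind :: "'a filter \<Rightarrow> ('a \<Rightarrow> 'b filter) \<Rightarrow> 'b filter" where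
  "filter_bind p q = Abs_filter (\<lambda>P. \<forall>\<^sub>F x in p. eventually P (q x))"

lemma eventually_filter_bind:
  "eventually P (filter_bind p q) \<longleftrightarrow> (\<forall>\<^sub>F x in p. eventually P (q x))"
  unfolding filter_bind_def
  by (rule eventually_Abs_filter, rule is_filter.intro)
     (auto simp: eventually_conj_iff elim!: eventually_mono)

definition uf_add :: "nat filter \<Rightarrow> nat filter \<Rightarrow> nat filter"  (infixl "\<oplus>\<^sub>\<beta>" 65) where
  "p \<oplus>\<^sub>\<beta> q = filter_bind p (\<lambda>x. filtermap (\<lambda>y. x + y) q)"

lemma eventually_uf_add:
  "(\<forall>\<^sub>F z in p \<oplus>\<^sub>\<beta> q. z \<in> A) \<longleftrightarrow> (\<forall>\<^sub>F x in p. \<forall>\<^sub>F y in q. x + y \<in> A)"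
  by (simp add: uf_add_def eventually_filter_bind eventually_filtermap)

text \<open>\<open>tensor p k\<close> is the tensor product of \<open>p 1, \<dots>, p k\<close>. The recursion starts at the only
  ultrafilter on the one-point space of \<open>0\<close>-tuples, which yields \<open>p 1\<close> for \<open>k = 1\<close>.\<close>

primrec tensor :: "(nat \<Rightarrow> nat filter) \<Rightarrow> nat \<Rightarrow> nat list filter" where
  "tensor p 0 = principal {[]}"
| "tensor p (Suc k) = filter_bind (tensor p k) (\<lambda>xs. filtermap (\<lambda>x. xs @ [x]) (p (Suc k)))"

lemma tensor_1: "tensor p 1 = filtermap (\<lambda>x. [x]) (p 1)"
  by (rule filter_eqI)
     (simp add: eventually_filter_bind eventually_filtermap eventually_principal)

lemma eventually_tensor_Suc:
  "(\<forall>\<^sub>F xs in tensor p (Suc k). xs \<in> A) \<longleftrightarrow>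
   (\<forall>\<^sub>F xs in tensor p k. \<forall>\<^sub>F x in p (Suc k). xs @ [x] \<in> A)"
  by (simp add: eventually_filter_bind eventually_filtermap)


section \<open>Minimal idempotents and the ideal of polynomial J-sets\<close>

definition two_sided_ideal :: "nat filter set \<Rightarrow> bool" where
  "two_sided_ideal I \<longleftrightarrow> I \<noteq> {} \<and> I \<subseteq> beta Npos \<and>
     (\<forall>p\<in>beta Npos. \<forall>q\<in>I. p \<oplus>\<^sub>\<beta> q \<in> I \<and> q \<oplus>\<^sub>\<beta> p \<in> I)"

definition smallest_ideal :: "nat filter set" where
  "smallest_ideal = \<Inter> {I. two_sided_ideal I}"

definition minimal_idempotents :: "nat filter set" where
  "minimal_idempotents = {p \<in> smallest_ideal. p \<oplus>\<^sub>\<beta> p = p}"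

definition Jp_set :: "nat set \<Rightarrow> bool" where
  "Jp_set A \<longleftrightarrow> A \<subseteq> Npos \<and>
     (\<forall>F\<in>Pf PP. \<forall>H\<in>Pf NN. \<exists>a\<in>Npos. \<exists>B\<in>Pf Npos. \<forall>P\<in>F. \<forall>f\<in>H.
        int a + poly P (int (\<Sum>t\<in>B. f t)) \<in> int ` A)"

definition Jp :: "nat filter set" where
  "Jp = {q \<in> beta Npos. \<forall>A\<subseteq>Npos. (\<forall>\<^sub>F x in q. x \<in> A) \<longrightarrow> Jp_set A}"

definition Jp_idempotents :: "nat filter set" where
  "Jp_idempotents = {p \<in> Jp. p \<oplus>\<^sub>\<beta> p = p}"


section \<open>The arguments of the polynomial\<close>

definition block_value ::
  "((nat \<Rightarrow> nat) set \<Rightarrow> nat) \<Rightarrow> ((nat \<Rightarrow> nat) set \<Rightarrow> nat set) \<Rightarrow>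
   (nat \<Rightarrow> (nat \<Rightarrow> nat) set) \<Rightarrow> (nat \<Rightarrow> nat \<Rightarrow> nat) \<Rightarrow> int poly \<Rightarrow> nat set \<Rightarrow> int" where
  "block_value \<alpha> H G f P B =
     int (\<Sum>i\<in>B. \<alpha> (G i)) + poly P (int (\<Sum>i\<in>B. \<Sum>t\<in>H (G i). f i t))"

end

theory Submission
  imports Defs "HOL-Library.Multiset"
begin

text \<open>Minimal idempotents lie in the ideal of polynomial J-sets as soon as this ideal is nonempty,
  which is an IP polynomial van der Waerden theorem: some ultrafilter consists of polynomial
  J-sets. It is found below a minimal shift-invariant filter \<open>F\<close> on the integers. For sets that
  are not null for \<open>F\<close> the Bergelson--Leibman argument (PET induction on families of polynomial maps,
  with colour focusing in the inductive step) goes through as in a minimal dynamical system.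

  Given idempotents in the ideal, \<open>\<alpha>(K)\<close> and \<open>H(K)\<close> are chosen by recursion on the finite set
  \<open>K\<close>, simultaneously for all ultrafilters among the \<open>p\<^sub>i\<close>. Only finitely many partial
  configurations of blocks arise from chains of proper subsets of \<open>K\<close>. For each of them the set of
  permitted increments belongs to the idempotent in question, and because \<open>P(z + w) - P(z)\<close> is a
  polynomial in \<open>w\<close> without constant term, the J-set property of the intersection of these sets
  yields increments for all the polynomials at once. As the choice is indexed by the ultrafilter
  and not by \<open>i\<close>, equal ultrafilters get equal functions.\<close>

subsection \<open>Minimal shift-invariant filters\<close>

text \<open>Zorn's lemma for the reversed order. The infimum of a chain of proper filters is proper,
  because the infimum of any finite part lies above some member of the chain.\<close>

lemma ex_minimal_filter:
  fixes F :: "'a filter"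
  assumes "F \<noteq> bot" and "Q F"
    and Inf: "\<And>C. C \<noteq> {} \<Longrightarrow> \<forall>A\<in>C. \<forall>B\<in>C. A \<le> B \<or> B \<le> A \<Longrightarrow> \<forall>A\<in>C. Q A \<Longrightarrow> Q (Inf C)"
  obtains M where "M \<le> F" "M \<noteq> bot" "Q M"
    "\<And>G. G \<noteq> bot \<Longrightarrow> Q G \<Longrightarrow> G \<le> M \<Longrightarrow> G = M"
proof -
  define A where "A = {G. G \<le> F \<and> G \<noteq> bot \<and> Q G}"
  have "\<exists>m\<in>A. \<forall>a\<in>A. m \<ge> a \<longrightarrow> a = m"
  proof (rule predicate_Zorn)
    show "partial_order_on A (relation_of (\<ge>) A)"
      by (auto simp: relation_of_def partial_order_on_def preorder_on_def refl_on_def trans_def antisym_def)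
    fix C assume C: "C \<in> Chains (relation_of (\<ge>) A)"
    have CA: "C \<subseteq> A" using C by (auto simp: Chains_def relation_of_def)
    have ch: "\<forall>X\<in>C. \<forall>Y\<in>C. X \<le> Y \<or> Y \<le> X"
      using C by (auto simp: Chains_def relation_of_def)
    show "\<exists>u\<in>A. \<forall>a\<in>C. a \<ge> u"
    proof (cases "C = {}")
      case True
      then show ?thesis using assms(1,2) by (auto simp: A_def)
    next
      case False
      have "Inf C \<noteq> bot"
      proof (rule Inf_filter_not_bot)
        fix X assume X: "X \<subseteq> C" "finite X"
        have "\<exists>x\<in>C. x \<le> Inf X" using X(2,1)
        proof (induction X)
          case empty
          then show ?case using False by auto
        next
          case (insert x X)
          then obtain y where "y \<in> C" "y \<le> Inf X" by auto
          with insert.prems ch show ?case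
            by (metis Inf_insert insert_subset le_inf_iff order_refl order_trans)
        qed
        then obtain x where "x \<in> C" "x \<le> Inf X" by auto
        moreover from this CA have "x \<noteq> bot" by (auto simp: A_def)
        ultimately show "Inf X \<noteq> bot" by (metis bot.extremum_uniqueI)
      qed
      moreover have "Q (Inf C)" using Inf[OF False ch] CA by (auto simp: A_def)
      moreover have "Inf C \<le> F" using False CA
        by (auto simp: A_def intro: Inf_lower2)
      ultimately have "Inf C \<in> A" by (auto simp: A_def)
      then show ?thesis by (auto intro: Inf_lower)
    qed
  qed
  then obtain M where M: "M \<in> A" "\<forall>a\<in>A. a \<le> M \<longrightarrow> a = M" by auto
  show thesis
  proof (rule that)
    show "M \<le> F" "M \<noteq> bot" "Q M" using M(1) by (auto simp: A_def)
    fix G assume "G \<noteq> bot" "Q G" "G \<le> M"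
    then show "G = M" using M by (auto simp: A_def)
  qed
qed

text \<open>A minimal proper filter \<open>M\<close> decides every \<open>P\<close>: its meet with
  the principal filter of \<open>P\<close> is either \<open>bot\<close>, so that \<open>P\<close>
  fails eventually, or \<open>M\<close> itself.\<close>

lemma ex_ultrafilter_le:
  fixes F :: "'a filter"
  assumes "F \<noteq> bot"
  obtains M where "M \<le> F" "M \<noteq> bot" "\<And>P. eventually P M \<or> eventually (\<lambda>x. \<not> P x) M"
proof -
  obtain M where M: "M \<le> F" "M \<noteq> bot" "\<And>G. G \<noteq> bot \<Longrightarrow> G \<le> M \<Longrightarrow> G = M"
    using ex_minimal_filter[of F "\<lambda>_. True"] assms by auto
  have "eventually P M \<or> eventually (\<lambda>x. \<not> P x) M" for P
  proof (cases "inf M (principal {x. P x}) = bot")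
    case True
    then have "eventually (\<lambda>_. False) (inf M (principal {x. P x}))" by simp
    then show ?thesis by (simp add: eventually_inf_principal)
  next
    case False
    then have "inf M (principal {x. P x}) = M" by (rule M(3)) simp
    moreover have "eventually P (inf M (principal {x. P x}))"
      by (simp add: eventually_inf_principal)
    ultimately have "eventually P M" by simp
    then show ?thesis ..
  qed
  with M(1,2) show thesis by (rule that)
qed

text \<open>In terms of the closed set of ultrafilters below \<open>F\<close>, this is invariance
  under all integer translations, in both directions.\<close>

definition shift_invariant :: "int filter \<Rightarrow> bool" where
  "shift_invariant F \<longleftrightarrow> (\<forall>k P. eventually P F \<longrightarrow> eventually (\<lambda>x. P (x + k)) F)"

lemma shift_invariant_at_top: "shift_invariant at_top"
  unfolding shift_invariant_def
proof (intro allI impI)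
  fix k :: int and P :: "int \<Rightarrow> bool" assume "eventually P at_top"
  then obtain N where "\<forall>n\<ge>N. P n" unfolding eventually_at_top_linorder ..
  then show "eventually (\<lambda>x. P (x + k)) at_top"
    by (auto simp: eventually_at_top_linorder intro!: exI[of _ "N - k"])
qed

lemma shift_invariant_Inf_chain:
  assumes "C \<noteq> {}" "\<forall>A\<in>C. \<forall>B\<in>C. A \<le> B \<or> B \<le> A" "\<forall>F\<in>C. shift_invariant F"
  shows "shift_invariant (Inf C)"
proof -
  have "eventually P (Inf C) \<longleftrightarrow> (\<exists>F\<in>C. eventually P F)" for P
    using assms(1,2) by (intro eventually_Inf_base) (metis inf.absorb1 inf.absorb2 order_refl)+
  then show ?thesis using assms(3) unfolding shift_invariant_def by blast
qed

text \<open>Minimality of a shift-invariant filter plays the role of minimality of a dynamical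
  system: finitely many translates of a set that is large in it cover it.\<close>

definition minimal_invariant :: "int filter \<Rightarrow> bool" where
  "minimal_invariant F \<longleftrightarrow> F \<noteq> bot \<and> shift_invariant F \<and>
     (\<forall>G. G \<noteq> bot \<longrightarrow> shift_invariant G \<longrightarrow> G \<le> F \<longrightarrow> G = F)"

text \<open>Starting Zorn's lemma at \<open>at_top\<close> ensures that the ultrafilters below
  \<open>F\<close> live on the positive integers.\<close>

lemma ex_minimal_invariant: obtains F where "minimal_invariant F" "F \<le> at_top"
proof -
  obtain M :: "int filter" where "M \<le> at_top" "M \<noteq> bot" "shift_invariant M"
    "\<And>G. G \<noteq> bot \<Longrightarrow> shift_invariant G \<Longrightarrow> G \<le> M \<Longrightarrow> G = M"
  proof (rule ex_minimal_filter)
    show "(at_top :: int filter) \<noteq> bot" by simp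
    show "shift_invariant at_top" by (rule shift_invariant_at_top)
  qed (use shift_invariant_Inf_chain in auto)
  then show thesis by (intro that) (auto simp: minimal_invariant_def)
qed

text \<open>Large sets, the members of some ultrafilter below \<open>F\<close>, take the place of
  nonempty open sets in a minimal system.\<close>

abbreviation large :: "int filter \<Rightarrow> int set \<Rightarrow> bool" where
  "large F U \<equiv> \<exists>\<^sub>F x in F. x \<in> U"

lemma large_shift:
  assumes "shift_invariant F" "large F U"
  shows "large F {x. x + k \<in> U}"
proof (rule ccontr)
  assume "\<not> large F {x. x + k \<in> U}"
  then have "\<forall>\<^sub>F x in F. x + k \<notin> U" by (simp add: frequently_def)
  with assms(1) have "\<forall>\<^sub>F x in F. x + - k + k \<notin> U"
    unfolding shift_invariant_def by blast
  with assms(2) show False by (simp add: frequently_def)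
qed

text \<open>If no finite \<open>N\<close> works, then \<open>F\<close> and the sets of points whose
  translates by a finite \<open>N\<close> all avoid \<open>U\<close> generate a proper invariant
  filter \<open>G\<close>. Minimality gives \<open>G = F\<close>, yet \<open>G\<close> contains the
  complement of \<open>U\<close>.\<close>

lemma large_imp_syndetic:
  assumes F: "minimal_invariant F" and U: "large F U"
  obtains N where "finite N" "\<forall>\<^sub>F x in F. \<exists>n\<in>N. x + n \<in> U"
proof (rule ccontr)
  assume "\<not> thesis"
  then have no: "\<not> (\<forall>\<^sub>F x in F. \<exists>n\<in>N. x + n \<in> U)" if "finite N" for N
    using that \<open>\<And>N. \<lbrakk>finite N; \<forall>\<^sub>F x in F. \<exists>n\<in>N. x + n \<in> U\<rbrakk> \<Longrightarrow> thesis\<close> by blast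
  define G where "G = Abs_filter (\<lambda>P. \<exists>N. finite N \<and> (\<forall>\<^sub>F x in F. (\<forall>n\<in>N. x + n \<notin> U) \<longrightarrow> P x))"
  have evG: "eventually P G \<longleftrightarrow> (\<exists>N. finite N \<and> (\<forall>\<^sub>F x in F. (\<forall>n\<in>N. x + n \<notin> U) \<longrightarrow> P x))" for P
    unfolding G_def
  proof (rule eventually_Abs_filter, rule is_filter.intro)
    show "\<exists>N. finite N \<and> (\<forall>\<^sub>F x in F. (\<forall>n\<in>N. x + n \<notin> U) \<longrightarrow> True)" by auto
  next
    fix P Q
    assume "\<exists>N. finite N \<and> (\<forall>\<^sub>F x in F. (\<forall>n\<in>N. x + n \<notin> U) \<longrightarrow> P x)"
      "\<exists>N. finite N \<and> (\<forall>\<^sub>F x in F. (\<forall>n\<in>N. x + n \<notin> U) \<longrightarrow> Q x)"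
    then obtain N N' where "finite N" "\<forall>\<^sub>F x in F. (\<forall>n\<in>N. x + n \<notin> U) \<longrightarrow> P x"
      "finite N'" "\<forall>\<^sub>F x in F. (\<forall>n\<in>N'. x + n \<notin> U) \<longrightarrow> Q x" by blast
    then show "\<exists>N. finite N \<and> (\<forall>\<^sub>F x in F. (\<forall>n\<in>N. x + n \<notin> U) \<longrightarrow> P x \<and> Q x)"
      by (intro exI[of _ "N \<union> N'"]) (auto elim: eventually_elim2)
  next
    fix P Q assume "\<forall>x. P x \<longrightarrow> Q x"
      "\<exists>N. finite N \<and> (\<forall>\<^sub>F x in F. (\<forall>n\<in>N. x + n \<notin> U) \<longrightarrow> P x)"
    then show "\<exists>N. finite N \<and> (\<forall>\<^sub>F x in F. (\<forall>n\<in>N. x + n \<notin> U) \<longrightarrow> Q x)"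
      by (auto elim!: eventually_mono)
  qed
  have inv: "shift_invariant F" using F by (simp add: minimal_invariant_def)
  have "G \<noteq> bot"
  proof
    assume "G = bot"
    then have "eventually (\<lambda>_. False) G" by simp
    then show False using no unfolding evG by (auto elim!: eventually_mono)
  qed
  moreover have "shift_invariant G"
    unfolding shift_invariant_def evG
  proof (intro allI impI, elim exE conjE)
    fix k P N assume N: "finite N" "\<forall>\<^sub>F x in F. (\<forall>n\<in>N. x + n \<notin> U) \<longrightarrow> P x"
    then have "\<forall>\<^sub>F x in F. (\<forall>n\<in>N. x + k + n \<notin> U) \<longrightarrow> P (x + k)"
      using inv unfolding shift_invariant_def by blast
    then show "\<exists>N. finite N \<and> (\<forall>\<^sub>F x in F. (\<forall>n\<in>N. x + n \<notin> U) \<longrightarrow> P (x + k))"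
      using N(1) by (intro exI[of _ "(+) k ` N"]) (auto simp: add.assoc)
  qed
  moreover have "G \<le> F" unfolding le_filter_def evG by (auto intro!: exI[of _ "{}"])
  ultimately have "G = F" using F by (simp add: minimal_invariant_def)
  moreover have "eventually (\<lambda>x. x \<notin> U) G" unfolding evG by (auto intro!: exI[of _ "{0}"])
  ultimately show False using U by (simp add: frequently_def)
qed

text \<open>Pigeonhole: finitely many translates of \<open>U\<close> cover almost all of
  \<open>W\<close>, and a finite union is large only if one of its parts is.\<close>

lemma large_Int_translate:
  assumes "\<forall>\<^sub>F x in F. \<exists>n\<in>N. x + n \<in> U" "finite N" "large F W"
  obtains n where "n \<in> N" "large F (W \<inter> {x. x + n \<in> U})"
proof -
  have "\<exists>\<^sub>F x in F. \<exists>n\<in>N. x \<in> W \<inter> {x. x + n \<in> U}"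
    by (rule frequently_rev_mp[OF assms(3)]) (use assms(1) in \<open>auto elim: eventually_mono\<close>)
  then have "\<exists>n\<in>N. large F (W \<inter> {x. x + n \<in> U})"
    by (rule frequently_bex_finite[OF assms(2)])
  then show thesis using that by blast
qed

subsection \<open>Polynomial maps\<close>

text \<open>Degree at most \<open>d\<close>, measured by polarization so that the domain need only
  be a commutative monoid. Subtracting \<open>v y\<close> makes the difference vanish at
  \<open>0\<close> again.\<close>

fun polymap :: "nat \<Rightarrow> ('a::comm_monoid_add \<Rightarrow> int) \<Rightarrow> bool" where
  "polymap 0 v \<longleftrightarrow> v = (\<lambda>_. 0)"
| "polymap (Suc d) v \<longleftrightarrow> v 0 = 0 \<and> (\<forall>y. polymap d (\<lambda>x. v (x + y) - v x - v y))"

lemma polymap_zero: "polymap d (\<lambda>_. 0)"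
  by (induction d) auto

lemma polymap_diff: "polymap d v \<Longrightarrow> polymap d w \<Longrightarrow> polymap d (\<lambda>x. v x - w x)"
proof (induction d arbitrary: v w)
  case (Suc d)
  have "polymap d (\<lambda>x. v (x + y) - w (x + y) - (v x - w x) - (v y - w y))" for y
  proof -
    have "polymap d (\<lambda>x. (v (x + y) - v x - v y) - (w (x + y) - w x - w y))"
      by (rule Suc.IH) (use Suc.prems in auto)
    then show ?thesis by (simp add: algebra_simps)
  qed
  then show ?case using Suc.prems by simp
qed simp

lemma polymap_add:
  assumes "polymap d v" "polymap d w"
  shows "polymap d (\<lambda>x. v x + w x)"
proof -
  have "polymap d (\<lambda>x. v x - (0 - w x))"
    by (intro polymap_diff polymap_zero assms)
  then show ?thesis by simp
qed

lemma polymap_Suc: "polymap d v \<Longrightarrow> polymap (Suc d) v"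
proof (induction d arbitrary: v)
  case (Suc d)
  have "v 0 = 0" "\<And>y. polymap d (\<lambda>x. v (x + y) - v x - v y)" using Suc.prems by auto
  then show ?case by (subst polymap.simps) (blast intro: Suc.IH)
qed simp

lemma polymap_mono:
  assumes "polymap d v" "d \<le> e"
  shows "polymap e v"
  using assms(2,1) by (induction rule: dec_induct) (blast intro: polymap_Suc)+

text \<open>Composing \<open>P\<close> with a monic linear polynomial preserves degree and leading
  coefficient, so subtracting \<open>P\<close> cancels the coefficient of
  \<open>Suc d\<close>.\<close>

lemma polymap_poly:
  assumes "\<And>x y. \<phi> (x + y) = \<phi> x + \<phi> y" "\<phi> 0 = 0"
  shows "degree P \<le> d \<Longrightarrow> coeff P 0 = 0 \<Longrightarrow> polymap d (\<lambda>x. poly P (\<phi> x))"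
proof (induction d arbitrary: P)
  case 0
  then have "P = 0" by (metis le_zero_eq leading_coeff_0_iff)
  then show ?case by simp
next
  case (Suc d)
  have "polymap d (\<lambda>x. poly P (\<phi> (x + y)) - poly P (\<phi> x) - poly P (\<phi> y))" for y
  proof -
    define Q where "Q = P \<circ>\<^sub>p [:\<phi> y, 1:] - P - [:poly P (\<phi> y):]"
    have eq: "poly P (\<phi> (x + y)) - poly P (\<phi> x) - poly P (\<phi> y) = poly Q (\<phi> x)" for x
      by (simp add: Q_def poly_pcompose assms(1) add.commute)
    have 0: "coeff Q 0 = 0"
      using Suc.prems(2) by (simp add: Q_def)
    have "degree (P \<circ>\<^sub>p [:\<phi> y, 1:]) = degree P"
      by (simp add: degree_pcompose)
    moreover have "lead_coeff (P \<circ>\<^sub>p [:\<phi> y, 1:]) = lead_coeff P"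
      by (subst lead_coeff_comp) auto
    ultimately have "coeff (P \<circ>\<^sub>p [:\<phi> y, 1:]) (Suc d) = coeff P (Suc d)"
      using Suc.prems(1) by (cases "degree P = Suc d") (auto simp: coeff_eq_0)
    then have "coeff Q (Suc d) = 0" by (simp add: Q_def coeff_pCons)
    moreover have "degree Q \<le> Suc d" unfolding Q_def using Suc.prems(1)
      by (intro degree_diff_le) (auto simp: degree_pcompose)
    ultimately have "degree Q \<le> d" using eq_zero_or_degree_less by fastforce
    with 0 show ?thesis unfolding eq by (intro Suc.IH)
  qed
  moreover have "poly P (\<phi> 0) = 0" using Suc.prems(2) by (simp add: assms(2) poly_0_coeff_0)
  ultimately show ?case by simp
qed

subsection \<open>Polynomial recurrence along an IP set\<close>

definition block :: "nat \<Rightarrow> nat set \<Rightarrow> bool" where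
  "block N b \<longleftrightarrow> finite b \<and> b \<noteq> {} \<and> (\<forall>t\<in>b. N \<le> t)"

text \<open>The maps live on finite multisets of indices, the free commutative monoid, because
  polarization needs a sum; unions of disjoint blocks become sums there.\<close>

definition returns :: "(nat multiset \<Rightarrow> int) set \<Rightarrow> int set \<Rightarrow> nat set \<Rightarrow> int set" where
  "returns A U b = {x \<in> U. \<forall>v\<in>A. x + v (mset_set b) \<in> U}"

definition recurrent :: "int filter \<Rightarrow> (nat multiset \<Rightarrow> int) set \<Rightarrow> bool" where
  "recurrent F A \<longleftrightarrow>
     (\<forall>U N. large F U \<longrightarrow> (\<exists>b. block N b \<and> large F (returns A U b)))"

text \<open>The increments of \<open>v\<close> from an earlier position \<open>\<gamma>\<close>,
  measured relative to \<open>w\<close>: the differencing step of PET induction.\<close>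

definition derived ::
  "(nat multiset \<Rightarrow> int) set \<Rightarrow> (nat multiset \<Rightarrow> int) \<Rightarrow> nat multiset set \<Rightarrow> (nat multiset \<Rightarrow> int) set" where
  "derived A w \<Gamma> = (\<lambda>(v, \<gamma>). \<lambda>x. v (x + \<gamma>) - v \<gamma> - w x) ` (A \<times> \<Gamma>)"

text \<open>Colour focusing: \<open>W\<close> lies in the translate of \<open>U\<close> by \<open>n\<close>, and moving it by the values
  at the blocks of \<open>X\<close> brings it into the translates recorded in \<open>X\<close>. Once \<open>n\<close> itself is
  recorded, the corresponding block is a return block for \<open>U\<close>.\<close>

lemma recurrent_if_derived:
  assumes F: "minimal_invariant F" and A: "finite A" "\<And>v. v \<in> A \<Longrightarrow> v {#} = 0"
    and der: "\<And>\<Gamma>. finite \<Gamma> \<Longrightarrow> recurrent F (derived A w \<Gamma>)"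
  shows "recurrent F A"
  unfolding recurrent_def
proof (intro allI impI)
  fix U N assume U: "large F U"
  have inv: "shift_invariant F" using F by (simp add: minimal_invariant_def)
  obtain C where C: "finite C" "\<forall>\<^sub>F x in F. \<exists>n\<in>C. x + n \<in> U"
    using large_imp_syndetic[OF F U] .
  define focused where "focused W n X \<longleftrightarrow> large F W \<and> n \<in> C \<and> (\<forall>x\<in>W. x + n \<in> U) \<and> finite X \<and>
    snd ` X \<subseteq> C \<and> (\<forall>(b, c)\<in>X. block N b \<and> (\<forall>v\<in>A. \<forall>x\<in>W. x + v (mset_set b) + c \<in> U))"
    for W n and X :: "(nat set \<times> int) set"
  have focus: "\<exists>W n X. focused W n X \<and> (n \<in> snd ` X \<or> card (snd ` X) \<ge> k)" for k
  proof (induction k)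
    case 0
    obtain n where "n \<in> C" "large F (UNIV \<inter> {x. x + n \<in> U})"
      using large_Int_translate[OF C(2,1), of UNIV] F
      by (auto simp: minimal_invariant_def)
    then have "focused {x. x + n \<in> U} n {}" by (auto simp: focused_def)
    then show ?case by blast
  next
    case (Suc k)
    then obtain W n X where foc: "focused W n X" and or: "n \<in> snd ` X \<or> card (snd ` X) \<ge> k"
      by blast
    show ?case
    proof (cases "n \<in> snd ` X")
      case True
      then show ?thesis using foc by blast
    next
      case False
      have X: "finite X" "\<And>b c. (b, c) \<in> X \<Longrightarrow> block N b"
        and W: "large F W" "n \<in> C" "snd ` X \<subseteq> C" "\<And>x. x \<in> W \<Longrightarrow> x + n \<in> U"
        and moved: "\<And>b c v x. (b, c) \<in> X \<Longrightarrow> v \<in> A \<Longrightarrow> x \<in> W \<Longrightarrow> x + v (mset_set b) + c \<in> U"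
        using foc unfolding focused_def by blast+
      have "finite (\<Union>(fst ` X))" using X by (auto simp: block_def)
      \<comment> \<open>A bound for all indices used so far; a block beyond \<open>M\<close> is
        disjoint from the recorded ones.\<close>
      then obtain M where M: "\<And>b c t. (b, c) \<in> X \<Longrightarrow> t \<in> b \<Longrightarrow> t < M"
        unfolding finite_nat_set_iff_bounded by force
      \<comment> \<open>\<open>{#}\<close> serves the new block by itself, the other elements serve
        its unions with the recorded blocks.\<close>
      define \<Gamma> where "\<Gamma> = insert {#} ((\<lambda>(b, c). mset_set b) ` X)"
      have "finite \<Gamma>" using X by (simp add: \<Gamma>_def)
      from der[OF this] obtain b where b: "block (max M N) b"
        and ret: "large F (returns (derived A w \<Gamma>) W b)"
        using W(1) unfolding recurrent_def by blast
      \<comment> \<open>Translating by the value of \<open>w\<close> cancels the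
        \<open>- w x\<close> in the derived maps.\<close>
      define W1 where "W1 = {x. x + w (mset_set b) \<in> returns (derived A w \<Gamma>) W b}"
      have "large F W1" unfolding W1_def by (rule large_shift[OF inv ret])
      then obtain n' where n': "n' \<in> C" and W2: "large F (W1 \<inter> {x. x + n' \<in> U})"
        using large_Int_translate[OF C(2,1)] by blast
      define W2 where "W2 = W1 \<inter> {x. x + n' \<in> U}"
      \<comment> \<open>The block \<open>b\<close> leads into \<open>W\<close>, hence records the
        old target \<open>n\<close>; recorded blocks are enlarged by \<open>b\<close> and keep their
        targets.\<close>
      define X2 where "X2 = insert (b, n) ((\<lambda>(c, k). (b \<union> c, k)) ` X)"
      have W1: "x + (v (mset_set b + \<gamma>) - v \<gamma>) \<in> W" if "x \<in> W1" "v \<in> A" "\<gamma> \<in> \<Gamma>" for x v \<gamma>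
        using that unfolding W1_def returns_def derived_def by force
      have new: "x + v (mset_set b) + n \<in> U" if "x \<in> W2" "v \<in> A" for x v
      proof -
        have "x + (v (mset_set b + {#}) - v {#}) \<in> W"
          using that by (intro W1) (auto simp: W2_def \<Gamma>_def)
        then show ?thesis using W(4) A(2)[OF that(2)] by simp
      qed
      have old: "x + v (mset_set (b \<union> c)) + k \<in> U" if "x \<in> W2" "v \<in> A" "(c, k) \<in> X" for x v c k
      proof -
        have "b \<inter> c = {}" using b M[OF that(3)] by (force simp: block_def)
        moreover have "finite b" "finite c" using b X(2)[OF that(3)] by (auto simp: block_def)
        ultimately have eq: "mset_set (b \<union> c) = mset_set b + mset_set c"
          by (simp add: mset_set_Union)
        \<comment> \<open>From this point of \<open>W\<close> the recorded block \<open>c\<close>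
          leads on into the translate of \<open>U\<close> by \<open>k\<close>, and its value
          \<open>v (mset_set c)\<close> cancels.\<close>
        have "x + (v (mset_set b + mset_set c) - v (mset_set c)) \<in> W"
          using that by (intro W1) (force simp: W2_def \<Gamma>_def)+
        from moved[OF that(3,2) this] show ?thesis unfolding eq by simp
      qed
      have "snd ` X2 = insert n (snd ` X)" by (force simp: X2_def)
      moreover have "block N b" using b by (auto simp: block_def)
      moreover have "block N (b \<union> c)" if "(c, k) \<in> X" for c k
        using X(2)[OF that] b by (auto simp: block_def)
      ultimately have "focused W2 n' X2"
        unfolding focused_def using W(2,3) W2 X(1) n' new old
        by (auto simp: W2_def X2_def)
      moreover have "card (snd ` X2) \<ge> Suc k"
        using False or X(1) \<open>snd ` X2 = _\<close> by simp
      ultimately show ?thesis by blast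
    qed
  qed
  obtain W n X where foc: "focused W n X" and or: "n \<in> snd ` X \<or> card (snd ` X) \<ge> Suc (card C)"
    using focus[of "Suc (card C)"] by blast
  \<comment> \<open>All targets lie in \<open>C\<close>, so \<open>Suc (card C)\<close> of them are
    impossible and \<open>n\<close> must be recorded.\<close>
  have "card (snd ` X) \<le> card C" using foc C(1) by (intro card_mono) (auto simp: focused_def)
  with or obtain b where b: "(b, n) \<in> X" by force
  \<comment> \<open>If \<open>x - n\<close> is in \<open>W\<close>, then both \<open>x\<close> and
    \<open>x + v (mset_set b)\<close> are in \<open>U\<close>.\<close>
  have "large F {x. x + - n \<in> W}" using foc by (intro large_shift[OF inv]) (simp add: focused_def)
  then have "large F (returns A U b)"
    using foc b by (elim frequently_elim1) (fastforce simp: focused_def returns_def)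
  moreover have "block N b" using foc b by (auto simp: focused_def)
  ultimately show "\<exists>b. block N b \<and> large F (returns A U b)" by blast
qed

section \<open>PET induction on coverings by balls\<close>

text \<open>A ball \<open>(c, d)\<close> consists of the maps that differ from \<open>c\<close> by a map of degree at most \<open>d\<close>.\<close>

definition covered :: "(nat multiset \<Rightarrow> int) set \<Rightarrow> ((nat multiset \<Rightarrow> int) \<times> nat) multiset \<Rightarrow> bool" where
  "covered A R \<longleftrightarrow> (\<forall>(c, d)\<in>#R. polymap (Suc d) c) \<and>
     (\<forall>v\<in>A. v = (\<lambda>_. 0) \<or> (\<exists>(c, d)\<in>#R. polymap d (\<lambda>x. v x - c x)))"

lemma polymap_if_near:
  assumes "polymap (Suc d) c" "polymap d (\<lambda>x. v x - c x)"
  shows "polymap (Suc d) v"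
  using polymap_add[OF polymap_Suc[OF assms(2)] assms(1)] by simp

lemma covered_at_zero:
  assumes "covered A R" "v \<in> A"
  shows "v {#} = 0"
proof (cases "v = (\<lambda>_. 0)")
  case False
  with assms obtain c d where "polymap (Suc d) c" "polymap d (\<lambda>x. v x - c x)"
    unfolding covered_def by blast
  from polymap_if_near[OF this] show ?thesis by simp
qed simp

text \<open>One step of PET induction: subtracting a map of a ball of least radius \<open>d\<close> removes this
  ball at the cost of finitely many balls of smaller radius.\<close>

lemma covered_derived:
  assumes A: "finite A" and R: "covered A (add_mset (c, d) R)"
    and min: "\<And>c' d'. (c', d') \<in># R \<Longrightarrow> d \<le> d'"
    and w: "w \<in> A" "polymap d (\<lambda>x. w x - c x)" and \<Gamma>: "finite \<Gamma>"
  obtains K where "covered (derived (A - {\<lambda>_. 0}) w \<Gamma>) (image_mset (\<lambda>(c, d). (\<lambda>x. c x - w x, d)) R + K)"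
    "\<forall>(c', d')\<in>#K. d' < d"
proof -
  define D where "D = {v \<in> derived (A - {\<lambda>_. 0}) w \<Gamma>. polymap d v}"
  \<comment> \<open>Derived maps of degree at most \<open>d\<close> become centres of balls of
    radius \<open>d - 1\<close>; for \<open>d = 0\<close> they vanish and need no ball.\<close>
  define K where "K = (if d = 0 then {#} else image_mset (\<lambda>v. (v, d - 1)) (mset_set D))"
  have fin: "finite D" unfolding D_def derived_def using A \<Gamma> by simp
  have c: "polymap (Suc d) c" using R by (simp add: covered_def)
  have wd: "polymap (Suc d) w"
    by (rule polymap_if_near[OF c w(2)])
  \<comment> \<open>Passing from \<open>v\<close> to its increments changes it by a map of degree at
    most \<open>e\<close>, so it stays in its ball while the centre moves by
    \<open>w\<close>.\<close>
  have shift: "polymap e (\<lambda>x. v (x + \<gamma>) - v \<gamma> - w x - (c' x - w x))"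
    if "polymap e (\<lambda>x. v x - c' x)" "polymap (Suc e) c'" for v c' e \<gamma>
  proof -
    have "polymap (Suc e) v"
      by (rule polymap_if_near[OF that(2,1)])
    then have "polymap e (\<lambda>x. v (x + \<gamma>) - v x - v \<gamma>)" by simp
    from polymap_add[OF this that(1)] show ?thesis by (simp add: algebra_simps)
  qed
  show thesis
  proof (rule that)
    show "\<forall>(c', d')\<in>#K. d' < d" by (auto simp: K_def)
    show "covered (derived (A - {\<lambda>_. 0}) w \<Gamma>) (image_mset (\<lambda>(c, d). (\<lambda>x. c x - w x, d)) R + K)"
      unfolding covered_def
    proof (intro conjI ballI)
      fix z assume z: "z \<in># image_mset (\<lambda>(c, d). (\<lambda>x. c x - w x, d)) R + K"
      obtain c' d' where zz: "z = (c', d')" by force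
      show "case z of (c, d) \<Rightarrow> polymap (Suc d) c"
      proof (cases "z \<in># K")
        case True
        then show ?thesis using fin by (auto simp: K_def D_def split: if_splits simp del: polymap.simps)
      next
        case False
        with z zz obtain c'' where c'': "(c'', d') \<in># R" "c' = (\<lambda>x. c'' x - w x)" by auto
        have "polymap (Suc d') c''" using R c'' by (auto simp: covered_def simp del: polymap.simps)
        \<comment> \<open>Here the minimality of \<open>d\<close> enters: the moved centre still has
          degree at most \<open>d' + 1\<close>.\<close>
        moreover have "polymap (Suc d') w" using polymap_mono[OF wd] min[OF c''(1)]
          by (simp del: polymap.simps)
        ultimately show ?thesis unfolding zz c''(2) prod.case by (rule polymap_diff)
      qed
    next
      fix u assume u: "u \<in> derived (A - {\<lambda>_. 0}) w \<Gamma>"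
      then obtain v \<gamma> where v: "v \<in> A" "v \<noteq> (\<lambda>_. 0)" and u_eq: "u = (\<lambda>x. v (x + \<gamma>) - v \<gamma> - w x)"
        by (auto simp: derived_def)
      from R v obtain c' d' where c': "(c', d') \<in># add_mset (c, d) R" "polymap d' (\<lambda>x. v x - c' x)"
        unfolding covered_def by blast
      then have "polymap (Suc d') c'" using R by (auto simp: covered_def simp del: polymap.simps)
      from shift[OF c'(2) this, of \<gamma>] have s: "polymap d' (\<lambda>x. u x - (c' x - w x))"
        by (simp add: u_eq)
      show "u = (\<lambda>_. 0) \<or> (\<exists>(c, d)\<in>#image_mset (\<lambda>(c, d). (\<lambda>x. c x - w x, d)) R + K. polymap d (\<lambda>x. u x - c x))"
      proof (cases "(c', d') \<in># R")
        case True
        then show ?thesis using s by force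
      next
        case False
        with c'(1) have [simp]: "c' = c" "d' = d" by auto
        have "polymap d (\<lambda>x. u x - (c x - w x))" using s by simp
        \<comment> \<open>\<open>u\<close> is near \<open>c - w\<close> and \<open>w\<close> is near
          \<open>c\<close>, so \<open>u\<close> itself has degree at most \<open>d\<close>.\<close>
        from polymap_diff[OF this w(2)] have du: "polymap d u" by simp
        show ?thesis
        proof (cases "d = 0")
          case True
          then show ?thesis using du by simp
        next
          case False
          have "(u, d - 1) \<in># K" using False fin du u by (auto simp: K_def D_def)
          moreover have "polymap (d - 1) (\<lambda>x. u x - u x)" by (simp add: polymap_zero)
          ultimately show ?thesis by (intro disjI2 bexI[of _ "(u, d - 1)"]) auto
        qed
      qed
    qed
  qed
qed

text \<open>Induction on the multiset of radii in the multiset order. A ball of least radius is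
  dropped if it contains no map of \<open>A\<close>; otherwise a map \<open>w\<close> in it is
  subtracted, which trades the ball for finitely many smaller ones.\<close>

lemma recurrent_covered:
  assumes F: "minimal_invariant F" and "finite A" "covered A R"
  shows "recurrent F A"
  using assms(2,3)
proof (induction "image_mset snd R" arbitrary: A R rule: wf_induct_rule[OF wf_mult1[OF wf_less]])
  case (1 R A)
  show ?case
  proof (cases "R = {#}")
    case True
    then have "returns A U b = U" for U b
      using 1(3) by (auto simp: covered_def returns_def)
    then have "block N {N} \<and> large F (returns A U {N})" if "large F U" for U N
      using that by (simp add: block_def)
    then show ?thesis unfolding recurrent_def by blast
  next
    case False
    define d where "d = Min (snd ` set_mset R)"
    have "d \<in> snd ` set_mset R" unfolding d_def using False by (intro Min_in) auto
    then obtain z where z: "z \<in># R" "snd z = d" by blast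
    obtain c where "z = (c, d)" using z(2) by (cases z) simp
    then obtain R' where R': "R = add_mset (c, d) R'"
      using multi_member_split[OF z(1)] by blast
    have min: "d \<le> d'" if "(c', d') \<in># R'" for c' d'
    proof -
      have "(c', d') \<in># R" using that R' by simp
      then have "d' \<in> snd ` set_mset R" by force
      then show ?thesis unfolding d_def by (intro Min_le) auto
    qed
    show ?thesis
    proof (cases "\<exists>w\<in>A. polymap d (\<lambda>x. w x - c x)")
      case False
      have "covered A R'" using 1(3) False unfolding R' covered_def by auto
      moreover have "(image_mset snd R', image_mset snd R) \<in> mult1 {(x, y). x < y}"
        by (rule mult1I[where K = "{#}"]) (auto simp: R')
      ultimately show ?thesis using 1(1,2) by blast
    next
      case True
      then obtain w where w: "w \<in> A" "polymap d (\<lambda>x. w x - c x)" by blast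
      \<comment> \<open>The zero map has to go first, since its derived map \<open>- w\<close> need
        not lie in any of the new balls.\<close>
      have "recurrent F (A - {\<lambda>_. 0})"
      proof (rule recurrent_if_derived[OF F])
        show "finite (A - {\<lambda>_. 0})" using 1(2) by simp
        show "v {#} = 0" if "v \<in> A - {\<lambda>_. 0}" for v
          using covered_at_zero[OF 1(3)] that by blast
        fix \<Gamma> :: "nat multiset set" assume \<Gamma>: "finite \<Gamma>"
        obtain K where K: "covered (derived (A - {\<lambda>_. 0}) w \<Gamma>) (image_mset (\<lambda>(c, d). (\<lambda>x. c x - w x, d)) R' + K)"
          "\<forall>(c', d')\<in>#K. d' < d"
          using covered_derived[OF 1(2) 1(3)[unfolded R'] min w \<Gamma>] .
        show "recurrent F (derived (A - {\<lambda>_. 0}) w \<Gamma>)"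
        proof (rule 1(1)[OF _ _ K(1)])
          show "finite (derived (A - {\<lambda>_. 0}) w \<Gamma>)" using 1(2) \<Gamma> by (simp add: derived_def)
          have "image_mset snd (image_mset (\<lambda>(c, d). (\<lambda>x. c x - w x, d)) R') = image_mset snd R'"
            by (simp add: multiset.map_comp comp_def case_prod_beta)
          then show "(image_mset snd (image_mset (\<lambda>(c, d). (\<lambda>x. c x - w x, d)) R' + K),
              image_mset snd R) \<in> mult1 {(x, y). x < y}"
            using K(2) by (intro mult1I[where K = "image_mset snd K"]) (auto simp: R')
        qed
      qed
      moreover have "returns A U b = returns (A - {\<lambda>_. 0}) U b" for U b
        by (auto simp: returns_def)
      ultimately show ?thesis by (simp add: recurrent_def)
    qed
  qed
qed

text \<open>Each map is the centre of a ball of its own.\<close>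

lemma recurrent_polymaps:
  assumes F: "minimal_invariant F" and A: "finite A" and "\<And>v. v \<in> A \<Longrightarrow> \<exists>d. polymap d v"
  shows "recurrent F A"
proof -
  obtain d where d: "\<And>v. v \<in> A \<Longrightarrow> polymap (d v) v" using assms(3) by metis
  show ?thesis
  proof (rule recurrent_covered[OF F A])
    show "covered A (image_mset (\<lambda>v. (v, d v)) (mset_set A))"
      using A d unfolding covered_def
      by (fastforce simp: polymap_zero simp del: polymap.simps intro!: polymap_Suc)
  qed
qed

subsection \<open>The ideal of polynomial J-sets\<close>

lemma beta_eventually_or: "q \<in> beta X \<Longrightarrow> eventually P q \<or> eventually (\<lambda>x. \<not> P x) q"
  by (simp add: beta_def)

lemma beta_eventually_mem: "q \<in> beta X \<Longrightarrow> \<forall>\<^sub>F x in q. x \<in> X"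
  by (simp add: beta_def le_principal)

lemma beta_ex: "q \<in> beta X \<Longrightarrow> eventually P q \<Longrightarrow> \<exists>x. P x"
  by (rule eventually_happens') (auto simp: beta_def trivial_limit_def)

lemma Pf_iff: "A \<in> Pf X \<longleftrightarrow> A \<subseteq> X \<and> finite A \<and> A \<noteq> {}"
  by (auto simp: Pf_def Fpow_def)

text \<open>Recurrence applies to the maps sending a multiset of indices to \<open>P\<close> of the
  sum of \<open>f\<close> over it. A returning point is \<open>a\<close>, and the block starts at
  \<open>1\<close> to stay inside \<open>Npos\<close>.\<close>

lemma Jp_set_if_large:
  assumes F: "minimal_invariant F" and top: "F \<le> at_top" and A: "A \<subseteq> Npos" "large F (int ` A)"
  shows "Jp_set A"
  unfolding Jp_set_def
proof (intro conjI ballI A(1))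
  fix Ps and H :: "(nat \<Rightarrow> nat) set" assume Ps: "Ps \<in> Pf PP" and H: "H \<in> Pf NN"
  define V where
    "V = (\<lambda>(P, f). \<lambda>x. poly P (int (sum_mset (image_mset f x)))) ` (Ps \<times> H)"
  have "recurrent F V"
  proof (rule recurrent_polymaps[OF F])
    show "finite V" using Ps H by (simp add: V_def Pf_iff)
    fix v assume "v \<in> V"
    then obtain P f where v: "v = (\<lambda>x. poly P (int (sum_mset (image_mset f x))))" and "P \<in> Ps"
      by (auto simp: V_def)
    then have "coeff P 0 = 0" using Ps by (auto simp: Pf_iff PP_def)
    then show "\<exists>d. polymap d v" unfolding v by (intro exI polymap_poly) auto
  qed
  then obtain b where b: "block 1 b" "large F (returns V (int ` A) b)"
    using A(2) unfolding recurrent_def by blast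
  then obtain x where x: "x \<in> returns V (int ` A) b" using frequentlyE by blast
  then obtain a where a: "a \<in> A" "x = int a" by (auto simp: returns_def)
  have "int a + poly P (int (\<Sum>t\<in>b. f t)) \<in> int ` A" if PH: "P \<in> Ps" "f \<in> H" for P f
  proof -
    have "(\<lambda>x. poly P (int (sum_mset (image_mset f x)))) \<in> V" using PH by (force simp: V_def)
    then show ?thesis using x a b(1) by (auto simp: returns_def sum_unfold_sum_mset)
  qed
  moreover have "b \<in> Pf Npos" using b(1) by (auto simp: block_def Pf_iff)
  ultimately show "\<exists>a\<in>Npos. \<exists>b\<in>Pf Npos. \<forall>P\<in>Ps. \<forall>f\<in>H. int a + poly P (int (\<Sum>t\<in>b. f t)) \<in> int ` A"
    using a A(1) by blast
qed

text \<open>Any ultrafilter below the minimal invariant filter will do, because all its members are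
  large.\<close>

lemma Jp_nonempty: "Jp \<noteq> {}"
proof -
  obtain F where F: "minimal_invariant F" "F \<le> at_top" by (rule ex_minimal_invariant)
  then have "F \<noteq> bot" by (simp add: minimal_invariant_def)
  then obtain M where M: "M \<le> F" "M \<noteq> bot" "\<And>P. eventually P M \<or> eventually (\<lambda>x. \<not> P x) M"
    using ex_ultrafilter_le by blast
  have pos: "\<forall>\<^sub>F x in M. 0 < x"
    using eventually_gt_at_top[of 0] M(1) F(2) by (meson filter_leD)
  have "filtermap nat M \<in> beta Npos"
    using M pos by (auto simp: beta_def filtermap_bot_iff le_principal eventually_filtermap)
  moreover have "Jp_set A" if "A \<subseteq> Npos" and A: "\<forall>\<^sub>F x in filtermap nat M. x \<in> A" for A
  proof (rule Jp_set_if_large[OF F that(1)])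
    have "\<forall>\<^sub>F x in M. x \<in> int ` A"
      using pos A unfolding eventually_filtermap
      by eventually_elim (auto simp: image_iff intro!: bexI[of _ "nat _"])
    then have "\<exists>\<^sub>F x in M. x \<in> int ` A" using M(2) by (rule eventually_frequently[rotated])
    then show "large F (int ` A)" using M(1) by (simp add: frequently_def) (meson filter_leD)
  qed
  ultimately show ?thesis by (auto simp: Jp_def)
qed

section \<open>The ideal property and minimal idempotents\<close>

lemma uf_add_in_beta:
  assumes "p \<in> beta Npos" "q \<in> beta Npos"
  shows "p \<oplus>\<^sub>\<beta> q \<in> beta Npos"
proof -
  have ev: "eventually P (p \<oplus>\<^sub>\<beta> q) \<longleftrightarrow> (\<forall>\<^sub>F x in p. \<forall>\<^sub>F y in q. P (x + y))" for P
    using eventually_uf_add[of "Collect P" p q] by simp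
  have "p \<noteq> bot" "q \<noteq> bot" using assms by (auto simp: beta_def)
  then have "\<not> eventually (\<lambda>_. False) (p \<oplus>\<^sub>\<beta> q)" unfolding ev by simp
  then have 1: "p \<oplus>\<^sub>\<beta> q \<noteq> bot" by auto
  have 2: "\<forall>\<^sub>F x in p \<oplus>\<^sub>\<beta> q. x \<in> Npos"
    unfolding ev using beta_eventually_mem[OF assms(1)] by (auto elim: eventually_mono)
  have "eventually P (p \<oplus>\<^sub>\<beta> q) \<or> eventually (\<lambda>x. \<not> P x) (p \<oplus>\<^sub>\<beta> q)" for P
  proof -
    have "(\<forall>\<^sub>F y in q. \<not> P (x + y)) \<longleftrightarrow> \<not> (\<forall>\<^sub>F y in q. P (x + y))" for x
    proof
      assume "\<forall>\<^sub>F y in q. \<not> P (x + y)"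
      then show "\<not> (\<forall>\<^sub>F y in q. P (x + y))"
        using eventually_conj[of "\<lambda>y. P (x + y)" q "\<lambda>y. \<not> P (x + y)"] \<open>q \<noteq> bot\<close>
        by (auto simp: trivial_limit_def)
    qed (use beta_eventually_or[OF assms(2)] in blast)
    then show ?thesis
      unfolding ev using beta_eventually_or[OF assms(1), of "\<lambda>x. \<forall>\<^sub>F y in q. P (x + y)"] by simp
  qed
  with 1 2 show ?thesis by (simp add: beta_def le_principal)
qed

lemma Jp_subset_beta: "Jp \<subseteq> beta Npos"
  by (auto simp: Jp_def)

lemma Jp_setE:
  assumes "Jp_set A" "Ps \<in> Pf PP" "H \<in> Pf NN"
  obtains a b where "a \<in> Npos" "b \<in> Pf Npos"
    "\<forall>P\<in>Ps. \<forall>f\<in>H. int a + poly P (int (\<Sum>t\<in>b. f t)) \<in> int ` A"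
proof -
  from assms(1) have "\<forall>F\<in>Pf PP. \<forall>H\<in>Pf NN. \<exists>a\<in>Npos. \<exists>b\<in>Pf Npos. \<forall>P\<in>F. \<forall>f\<in>H.
      int a + poly P (int (\<Sum>t\<in>b. f t)) \<in> int ` A"
    unfolding Jp_set_def by (rule conjunct2)
  from bspec[OF bspec[OF this assms(2)] assms(3)] show thesis
  proof (elim bexE)
    fix a b assume *: "a \<in> Npos" "b \<in> Pf Npos"
      "\<forall>P\<in>Ps. \<forall>f\<in>H. int a + poly P (int (\<Sum>t\<in>b. f t)) \<in> int ` A"
    then show thesis by (rule that)
  qed
qed

lemma Jp_set_translate:
  assumes "Jp_set {y \<in> Npos. x + y \<in> A}" "A \<subseteq> Npos"
  shows "Jp_set A"
  unfolding Jp_set_def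
proof (intro conjI ballI assms(2))
  fix Ps and H :: "(nat \<Rightarrow> nat) set" assume "Ps \<in> Pf PP" "H \<in> Pf NN"
  from Jp_setE[OF assms(1) this] obtain a b where a: "a \<in> Npos" and b: "b \<in> Pf Npos"
    and ab: "\<forall>P\<in>Ps. \<forall>f\<in>H. int a + poly P (int (\<Sum>t\<in>b. f t)) \<in> int ` {y \<in> Npos. x + y \<in> A}"
    .
  have "int (x + a) + poly P (int (\<Sum>t\<in>b. f t)) \<in> int ` A" if PH: "P \<in> Ps" "f \<in> H" for P f
  proof -
    obtain y where "x + y \<in> A" "int a + poly P (int (\<Sum>t\<in>b. f t)) = int y"
      using bspec[OF bspec[OF ab PH(1)] PH(2)] by blast
    then show ?thesis by (intro image_eqI[of _ _ "x + y"]) auto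
  qed
  moreover have "x + a \<in> Npos" using a by simp
  ultimately show "\<exists>a\<in>Npos. \<exists>b\<in>Pf Npos. \<forall>P\<in>Ps. \<forall>f\<in>H. int a + poly P (int (\<Sum>t\<in>b. f t)) \<in> int ` A"
    using b by blast
qed

text \<open>For \<open>p \<oplus>\<^sub>\<beta> q\<close>, a translate of \<open>A\<close> belongs
  to \<open>q\<close>. For \<open>q \<oplus>\<^sub>\<beta> p\<close>, the set \<open>D\<close> is in
  \<open>q\<close>; a finite pattern in \<open>D\<close> is moved into \<open>A\<close> by a single
  \<open>y\<close>, which is added to \<open>a\<close>.\<close>

lemma Jp_ideal: "two_sided_ideal Jp"
  unfolding two_sided_ideal_def
proof (intro conjI ballI Jp_nonempty Jp_subset_beta)
  fix p q assume p: "p \<in> beta Npos" and q: "q \<in> Jp"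
  then have qb: "q \<in> beta Npos" using Jp_subset_beta by blast
  have "Jp_set A" if A: "A \<subseteq> Npos" "\<forall>\<^sub>F x in p \<oplus>\<^sub>\<beta> q. x \<in> A" for A
  proof -
    from A(2) obtain x where x: "\<forall>\<^sub>F y in q. x + y \<in> A"
      unfolding eventually_uf_add using beta_ex[OF p] by blast
    then have "\<forall>\<^sub>F y in q. y \<in> {y \<in> Npos. x + y \<in> A}"
      using beta_eventually_mem[OF qb] by eventually_elim simp
    moreover have "{y \<in> Npos. x + y \<in> A} \<subseteq> Npos" by blast
    ultimately have "Jp_set {y \<in> Npos. x + y \<in> A}" using q unfolding Jp_def by blast
    then show ?thesis using A(1) by (rule Jp_set_translate)
  qed
  then show "p \<oplus>\<^sub>\<beta> q \<in> Jp" using uf_add_in_beta[OF p qb] by (simp add: Jp_def)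
  have "Jp_set A" if A: "A \<subseteq> Npos" "\<forall>\<^sub>F x in q \<oplus>\<^sub>\<beta> p. x \<in> A" for A
    unfolding Jp_set_def
  proof (intro conjI ballI A(1))
    fix Ps and H :: "(nat \<Rightarrow> nat) set" assume Ps: "Ps \<in> Pf PP" and H: "H \<in> Pf NN"
    define D where "D = {x \<in> Npos. \<forall>\<^sub>F y in p. x + y \<in> A}"
    have "\<forall>\<^sub>F x in q. x \<in> D"
      using A(2) beta_eventually_mem[OF qb] unfolding eventually_uf_add D_def
      by eventually_elim simp
    moreover have "D \<subseteq> Npos" by (auto simp: D_def)
    ultimately have "Jp_set D" using q unfolding Jp_def by blast
    from Jp_setE[OF this Ps H] obtain a b where a: "a \<in> Npos" and b: "b \<in> Pf Npos"
      and ab: "\<forall>P\<in>Ps. \<forall>f\<in>H. int a + poly P (int (\<Sum>t\<in>b. f t)) \<in> int ` D"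
    .
    have "\<forall>\<^sub>F y in p. int a + poly P (int (\<Sum>t\<in>b. f t)) + int y \<in> int ` A" if PH: "P \<in> Ps" "f \<in> H" for P f
    proof -
      obtain x where "x \<in> D" "int a + poly P (int (\<Sum>t\<in>b. f t)) = int x"
        using bspec[OF bspec[OF ab PH(1)] PH(2)] by blast
      then show ?thesis
        unfolding D_def by (auto elim!: eventually_mono simp: image_iff simp flip: of_nat_add)
    qed
    then have "\<forall>\<^sub>F y in p. \<forall>P\<in>Ps. \<forall>f\<in>H. int a + poly P (int (\<Sum>t\<in>b. f t)) + int y \<in> int ` A"
      using Ps H by (intro eventually_ball_finite ballI) (auto simp: Pf_iff)
    then obtain y where "\<forall>P\<in>Ps. \<forall>f\<in>H. int a + poly P (int (\<Sum>t\<in>b. f t)) + int y \<in> int ` A"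
      using beta_ex[OF p] by blast
    then have "\<forall>P\<in>Ps. \<forall>f\<in>H. int (a + y) + poly P (int (\<Sum>t\<in>b. f t)) \<in> int ` A"
      by (simp add: algebra_simps)
    moreover have "a + y \<in> Npos" using a by simp
    ultimately show "\<exists>a\<in>Npos. \<exists>b\<in>Pf Npos. \<forall>P\<in>Ps. \<forall>f\<in>H. int a + poly P (int (\<Sum>t\<in>b. f t)) \<in> int ` A"
      using b by blast
  qed
  then show "q \<oplus>\<^sub>\<beta> p \<in> Jp" using uf_add_in_beta[OF qb p] by (simp add: Jp_def)
qed

text \<open>The smallest ideal, as the intersection of all two-sided ideals, lies inside
  \<open>Jp\<close>.\<close>

lemma minimal_idempotents_subset: "minimal_idempotents \<subseteq> Jp_idempotents"
  using Jp_ideal by (auto simp: minimal_idempotents_def Jp_idempotents_def smallest_ideal_def)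

text \<open>Shifting the functions pushes the index set beyond any bound.\<close>

lemma Jp_set_beyond:
  assumes "Jp_set A" "Ps \<in> Pf PP" "H \<in> Pf NN"
  obtains a b where "a \<in> Npos" "b \<in> Pf Npos" "\<forall>t\<in>b. M < t"
    "\<forall>P\<in>Ps. \<forall>f\<in>H. int a + poly P (int (\<Sum>t\<in>b. f t)) \<in> int ` A"
proof -
  define sh :: "(nat \<Rightarrow> nat) \<Rightarrow> nat \<Rightarrow> nat" where "sh f = restrict (\<lambda>t. f (t + M)) Npos" for f
  have "sh f \<in> NN" if "f \<in> H" for f
  proof -
    have "f \<in> NN" using assms(3) that unfolding Pf_iff by blast
    then show ?thesis by (auto simp: sh_def PiE_iff)
  qed
  then have "sh ` H \<subseteq> NN" by blast
  then have "sh ` H \<in> Pf NN" using assms(3) by (simp add: Pf_iff)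
  from Jp_setE[OF assms(1,2) this] obtain a b where a: "a \<in> Npos" and b: "b \<in> Pf Npos"
    and ab: "\<forall>P\<in>Ps. \<forall>f\<in>sh ` H. int a + poly P (int (\<Sum>t\<in>b. f t)) \<in> int ` A"
    .
  have "(\<Sum>t\<in>(\<lambda>t. t + M) ` b. f t) = (\<Sum>t\<in>b. sh f t)" for f
  proof -
    have "(\<Sum>t\<in>(\<lambda>t. t + M) ` b. f t) = (\<Sum>t\<in>b. f (t + M))"
      by (simp add: sum.reindex comp_def)
    also have "\<dots> = (\<Sum>t\<in>b. sh f t)"
      using b by (intro sum.cong) (auto simp: sh_def Pf_iff)
    finally show ?thesis .
  qed
  then show thesis
    using a b ab by (intro that[of a "(\<lambda>t. t + M) ` b"]) (auto simp: Pf_iff)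
qed

subsection \<open>Partial configurations\<close>

fun extendable :: "(nat \<Rightarrow> nat filter) \<Rightarrow> nat list set \<Rightarrow> nat \<Rightarrow> nat list \<Rightarrow> bool" where
  "extendable p B 0 xs \<longleftrightarrow> xs \<in> B"
| "extendable p B (Suc k) xs \<longleftrightarrow> (\<forall>\<^sub>F x in p (Suc (length xs)). extendable p B k (xs @ [x]))"

lemma eventually_tensor_length: "\<forall>\<^sub>F xs in tensor p k. length xs = k"
  by (induction k) (auto simp: eventually_principal eventually_filter_bind eventually_filtermap
      elim!: eventually_mono)

text \<open>\<open>tensor\<close> splits off the last ultrafilter and \<open>extendable\<close> the
  first one; the induction carries the quantifiers over one at a time.\<close>

lemma extendable_tensor:
  "\<forall>\<^sub>F xs in tensor p j. extendable p B k xs \<Longrightarrow> extendable p B (j + k) []"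
proof (induction j arbitrary: k)
  case 0
  then show ?case by (simp add: eventually_principal)
next
  case (Suc j)
  have "\<forall>\<^sub>F xs in tensor p j. \<forall>\<^sub>F x in p (Suc j). extendable p B k (xs @ [x])"
    using Suc.prems by (simp add: eventually_filter_bind eventually_filtermap)
  with eventually_tensor_length[of j p] have "\<forall>\<^sub>F xs in tensor p j. extendable p B (Suc k) xs"
    by eventually_elim simp
  from Suc.IH[OF this] show ?case by simp
qed

definition star :: "nat filter \<Rightarrow> nat set \<Rightarrow> nat set" where
  "star q C = {x \<in> C. \<forall>\<^sub>F y in q. x + y \<in> C}"

lemma eventually_star:
  assumes "q \<oplus>\<^sub>\<beta> q = q" "\<forall>\<^sub>F x in q. x \<in> C"
  shows "\<forall>\<^sub>F x in q. x \<in> star q C"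
proof -
  have "\<forall>\<^sub>F x in q. \<forall>\<^sub>F y in q. x + y \<in> C" using assms eventually_uf_add[of C q q] by simp
  with assms(2) show ?thesis by eventually_elim (simp add: star_def)
qed

text \<open>Idempotence is applied to the translate of \<open>C\<close> by \<open>x\<close>, itself
  a member of \<open>q\<close>.\<close>

lemma star_translate:
  assumes "q \<oplus>\<^sub>\<beta> q = q" "x \<in> star q C"
  shows "\<forall>\<^sub>F y in q. x + y \<in> star q C"
proof -
  have C: "\<forall>\<^sub>F y in q. x + y \<in> C" using assms(2) by (simp add: star_def)
  then have "\<forall>\<^sub>F y in q \<oplus>\<^sub>\<beta> q. y \<in> {y. x + y \<in> C}" using assms(1) by simp
  then have "\<forall>\<^sub>F y in q. \<forall>\<^sub>F z in q. y + z \<in> {y. x + y \<in> C}" unfolding eventually_uf_add .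
  with C show ?thesis by eventually_elim (simp add: star_def add.assoc)
qed

lemma star_subset: "star q C \<subseteq> C"
  by (auto simp: star_def)

text \<open>The pair of \<alpha>(K) and H(K) at one set K, for each ultrafilter.\<close>

type_synonym choice = "nat filter \<Rightarrow> nat \<times> nat set"

text \<open>A state \<open>(xs, a, z)\<close> records the values \<open>xs\<close> of the completed blocks together with the
  sums \<open>a\<close> of the values \<open>\<alpha>(G)\<close> and \<open>z\<close> of the values \<open>f(t)\<close> over the block under construction.
  \<open>reach K\<close> consists of the states that arise from chains of proper subsets of \<open>K\<close>; the empty
  block has \<open>a = 0\<close>.\<close>

inductive reach :: "nat \<Rightarrow> (nat \<Rightarrow> nat filter) \<Rightarrow> int poly set \<Rightarrow>
    ((nat \<Rightarrow> nat) set \<Rightarrow> choice) \<Rightarrow> (nat \<Rightarrow> nat) set \<Rightarrow> nat list \<Rightarrow> nat \<Rightarrow> nat \<Rightarrow> bool"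
  for m p T \<Phi> where
  start: "reach m p T \<Phi> K [] 0 0"
| add: "reach m p T \<Phi> G xs a z \<Longrightarrow> G \<in> Pf NN \<Longrightarrow> G \<subset> K \<Longrightarrow> f \<in> G \<Longrightarrow> length xs < m \<Longrightarrow>
    reach m p T \<Phi> K xs (a + fst (\<Phi> G (p (Suc (length xs)))))
      (z + (\<Sum>t\<in>snd (\<Phi> G (p (Suc (length xs)))). f t))"
| close: "reach m p T \<Phi> K xs a z \<Longrightarrow> 0 < a \<Longrightarrow> P \<in> T \<Longrightarrow> length xs < m \<Longrightarrow>
    reach m p T \<Phi> K (xs @ [nat (int a + poly P (int z))]) 0 0"

text \<open>This makes recursion on \<open>K\<close> legitimate: only values of
  \<open>\<Phi>\<close> at proper subsets of \<open>K\<close> enter.\<close>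

lemma reach_cong:
  assumes "reach m p T \<Phi> K xs a z" "\<And>G. G \<in> Pf NN \<Longrightarrow> G \<subset> K \<Longrightarrow> \<Phi> G = \<Psi> G"
  shows "reach m p T \<Psi> K xs a z"
  using assms
proof induction
  case (add G xs a z K f)
  have "reach m p T \<Psi> G xs a z" using add.IH add.prems add.hyps by (metis psubset_trans)
  from reach.add[OF this add.hyps(2-5)] show ?case using add.prems[OF add.hyps(2,3)] by simp
qed (auto intro: reach.intros)

text \<open>States over \<open>K\<close> come from finitely many states over proper subsets by one
  addition, or from the start, giving \<open>I\<close>. Closing resets \<open>a\<close> to
  \<open>0\<close> and needs \<open>0 < a\<close>, so one round of closing exhausts the
  rest.\<close>

lemma finite_reach:
  assumes "finite T" "finite K"
  shows "finite {(xs, a, z). reach m p T \<Phi> K xs a z}"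
  using assms(2)
proof (induction K rule: finite_psubset_induct)
  case (psubset K)
  define R where "R G = {(xs, a, z). reach m p T \<Phi> G xs a z}" for G
  define adds :: "_ \<Rightarrow> _ \<Rightarrow> nat list \<times> nat \<times> nat \<Rightarrow> nat list \<times> nat \<times> nat" where
    "adds G f = (\<lambda>(xs, a, z). (xs, a + fst (\<Phi> G (p (Suc (length xs)))),
      z + (\<Sum>t\<in>snd (\<Phi> G (p (Suc (length xs)))). f t)))" for G f
  define closes :: "int poly \<Rightarrow> nat list \<times> nat \<times> nat \<Rightarrow> nat list \<times> nat \<times> nat" where
    "closes P = (\<lambda>(xs, a, z). (xs @ [nat (int a + poly P (int z))], 0, 0))" for P
  define I where "I = insert ([], 0, 0) (\<Union>G\<in>{G. G \<subset> K}. \<Union>f\<in>G. adds G f ` R G)"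
  have fin: "finite {G. G \<subset> K}" using psubset.hyps by (rule finite_subset[rotated, OF finite_Pow_iff[THEN iffD2]]) auto
  have "finite G" if "G \<subset> K" for G using that psubset.hyps finite_subset by blast
  then have "finite I" unfolding I_def using fin psubset.IH by (auto simp: R_def)
  define J where "J = I \<union> (\<Union>P\<in>T. closes P ` I)"
  have "reach m p T \<Phi> K' xs a z \<Longrightarrow> K' = K \<Longrightarrow> (xs, a, z) \<in> J \<and> (0 < a \<longrightarrow> (xs, a, z) \<in> I)" for K' xs a z
  proof (induction rule: reach.induct)
    case (add G xs a z K' f)
    then have "adds G f (xs, a, z) \<in> I"
      unfolding I_def R_def by blast
    then show ?case by (simp add: J_def adds_def)
  next
    case (close K' xs a z P)
    then have "closes P (xs, a, z) \<in> J" unfolding J_def by blast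
    then show ?case by (simp add: closes_def)
  qed (simp add: I_def J_def)
  then have "R K \<subseteq> J" by (auto simp: R_def)
  moreover have "finite J" using \<open>finite I\<close> assms(1) by (simp add: J_def)
  ultimately show ?case unfolding R_def by (rule finite_subset)
qed

section \<open>The recursive choice of increments\<close>

locale tensor_member =
  fixes m :: nat and p :: "nat \<Rightarrow> nat filter" and B :: "nat list set" and T :: "int poly set"
  assumes p: "\<And>i. i \<in> {1..m} \<Longrightarrow> p i \<in> Jp_idempotents"
    and B: "\<forall>\<^sub>F xs in tensor p m. xs \<in> B" and T: "T \<in> Pf PP"
begin

text \<open>Values of the next block that keep the prefix extendable; the star leaves room to
  prolong the block.\<close>

definition next_set :: "nat list \<Rightarrow> nat set" where
  "next_set xs = star (p (Suc (length xs)))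
    {x \<in> Npos. extendable p B (m - Suc (length xs)) (xs @ [x])}"

text \<open>The invariant of the recursion. As increments of \<open>a\<close> are positive,
  \<open>a = 0\<close> marks the empty block; otherwise the block must be ready to close with any
  \<open>P\<close> in \<open>T\<close>.\<close>

definition admissible :: "nat list \<Rightarrow> nat \<Rightarrow> nat \<Rightarrow> bool" where
  "admissible xs a z \<longleftrightarrow> length xs \<le> m \<and> extendable p B (m - length xs) xs \<and>
    (if a = 0 then z = 0
     else length xs < m \<and> (\<forall>P\<in>T. int a + poly P (int z) \<in> int ` next_set xs))"

lemma idem: "i \<in> {1..m} \<Longrightarrow> p i \<oplus>\<^sub>\<beta> p i = p i" and in_Jp: "i \<in> {1..m} \<Longrightarrow> p i \<in> Jp"
  using p by (auto simp: Jp_idempotents_def)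

lemma eventually_next_set:
  assumes "extendable p B (m - length xs) xs" "length xs < m"
  shows "\<forall>\<^sub>F x in p (Suc (length xs)). x \<in> next_set xs"
  unfolding next_set_def
proof (rule eventually_star)
  have i: "Suc (length xs) \<in> {1..m}" using assms(2) by simp
  then show "p (Suc (length xs)) \<oplus>\<^sub>\<beta> p (Suc (length xs)) = p (Suc (length xs))" by (rule idem)
  have "\<forall>\<^sub>F x in p (Suc (length xs)). x \<in> Npos"
    using in_Jp[OF i] Jp_subset_beta by (intro beta_eventually_mem) auto
  moreover have "m - length xs = Suc (m - Suc (length xs))" using assms(2) by simp
  then have "\<forall>\<^sub>F x in p (Suc (length xs)). extendable p B (m - Suc (length xs)) (xs @ [x])"
    using assms(1) by simp
  ultimately show "\<forall>\<^sub>F x in p (Suc (length xs)).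
      x \<in> {x \<in> Npos. extendable p B (m - Suc (length xs)) (xs @ [x])}"
    by eventually_elim simp
qed

text \<open>For the empty block the value is \<open>0\<close> and \<open>next_set\<close> itself is
  in the ultrafilter; otherwise the star property applies.\<close>

lemma admissible_eventually:
  assumes "admissible xs a z" "length xs < m" "P \<in> T"
  shows "\<forall>\<^sub>F y in p (Suc (length xs)). int a + poly P (int z) + int y \<in> int ` next_set xs"
proof (cases "a = 0")
  case True
  have "coeff P 0 = 0" using assms(3) T by (auto simp: Pf_iff PP_def)
  with True assms have "int a + poly P (int z) = 0" by (simp add: admissible_def poly_0_coeff_0)
  moreover have "\<forall>\<^sub>F x in p (Suc (length xs)). x \<in> next_set xs"
    using assms by (intro eventually_next_set) (simp_all add: admissible_def)
  ultimately show ?thesis by (auto elim: eventually_mono)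
next
  case False
  with assms obtain x where x: "x \<in> next_set xs" "int a + poly P (int z) = int x"
    by (auto simp: admissible_def)
  have "\<forall>\<^sub>F y in p (Suc (length xs)). x + y \<in> next_set xs"
    using x(1) assms(2) unfolding next_set_def by (intro star_translate idem) simp_all
  then show ?thesis unfolding x(2) by eventually_elim (metis imageI of_nat_add)
qed

text \<open>Vacuous outside \<open>Pf NN\<close>, so that the recursion can run over all sets
  \<open>K\<close>.\<close>

definition valid_choice ::
  "((nat \<Rightarrow> nat) set \<Rightarrow> choice) \<Rightarrow> (nat \<Rightarrow> nat) set \<Rightarrow> choice \<Rightarrow> bool" where
  "valid_choice \<Phi> K r \<longleftrightarrow> (K \<in> Pf NN \<longrightarrow> (\<forall>q\<in>p ` {1..m}.
     fst (r q) \<in> Npos \<and> snd (r q) \<in> Pf Npos \<and>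
     (\<forall>G\<in>Pf NN. G \<subset> K \<longrightarrow> snd (\<Phi> G q) \<lless> snd (r q)) \<and>
     (\<forall>xs a z. reach m p T \<Phi> K xs a z \<longrightarrow> length xs < m \<longrightarrow> p (Suc (length xs)) = q \<longrightarrow>
        (\<forall>P\<in>T. \<forall>f\<in>K. int (a + fst (r q)) + poly P (int (z + (\<Sum>t\<in>snd (r q). f t)))
           \<in> int ` next_set xs))))"

lemma valid_choiceD:
  assumes "valid_choice \<Phi> K r" "K \<in> Pf NN" "i \<in> {1..m}"
  shows "0 < fst (r (p i))" "snd (r (p i)) \<in> Pf Npos"
    "G \<in> Pf NN \<Longrightarrow> G \<subset> K \<Longrightarrow> snd (\<Phi> G (p i)) \<lless> snd (r (p i))"
    "reach m p T \<Phi> K xs a z \<Longrightarrow> length xs < m \<Longrightarrow> p (Suc (length xs)) = p i \<Longrightarrow> P \<in> T \<Longrightarrow> f \<in> K \<Longrightarrow>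
      int (a + fst (r (p i))) + poly P (int (z + (\<Sum>t\<in>snd (r (p i)). f t))) \<in> int ` next_set xs"
  using assms unfolding valid_choice_def by (simp_all add: image_iff)

lemma reach_admissible:
  assumes "reach m p T \<Phi> K xs a z" "\<And>G. G \<in> Pf NN \<Longrightarrow> G \<subset> K \<Longrightarrow> valid_choice \<Phi> G (\<Phi> G)"
  shows "admissible xs a z"
  using assms
proof induction
  case (start K)
  have "extendable p B (m + 0) []" using B by (intro extendable_tensor) simp
  then show ?case by (simp add: admissible_def)
next
  case (add G xs a z K f)
  have adm: "admissible xs a z" using add.IH add.prems add.hyps by (metis psubset_trans)
  have i: "Suc (length xs) \<in> {1..m}" using add.hyps by simp
  note v = valid_choiceD[OF add.prems[OF add.hyps(2,3)] add.hyps(2) i]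
  show ?case
    using adm add.hyps(5) v(1) v(4)[OF add.hyps(1,5) refl _ add.hyps(4)]
    by (simp add: admissible_def)
next
  case (close K xs a z P)
  then obtain x where x: "x \<in> next_set xs" "int a + poly P (int z) = int x"
    by (auto simp: admissible_def)
  then have "extendable p B (m - Suc (length xs)) (xs @ [x])"
    using star_subset unfolding next_set_def by blast
  then show ?case using x(2) close.hyps by (simp add: admissible_def)
qed

lemma ex_valid_choice:
  assumes valid: "\<And>G. G \<in> Pf NN \<Longrightarrow> G \<subset> K \<Longrightarrow> valid_choice \<Phi> G (\<Phi> G)"
  shows "\<exists>r. valid_choice \<Phi> K r"
proof (cases "K \<in> Pf NN")
  case True
  define R where "R = {(xs, a, z). reach m p T \<Phi> K xs a z}"
  have finT: "finite T" and TPP: "T \<subseteq> PP" using T by (auto simp: Pf_iff)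
  have finK: "finite K" using True by (simp add: Pf_iff)
  have finR: "finite R" unfolding R_def using finT finK by (rule finite_reach)
  have ex: "\<exists>b. fst b \<in> Npos \<and> snd b \<in> Pf Npos \<and>
     (\<forall>G\<in>Pf NN. G \<subset> K \<longrightarrow> snd (\<Phi> G q) \<lless> snd b) \<and>
     (\<forall>xs a z. reach m p T \<Phi> K xs a z \<longrightarrow> length xs < m \<longrightarrow> p (Suc (length xs)) = q \<longrightarrow>
        (\<forall>P\<in>T. \<forall>f\<in>K. int (a + fst b) + poly P (int (z + (\<Sum>t\<in>snd b. f t))) \<in> int ` next_set xs))"
    if q: "q \<in> p ` {1..m}" for q
  proof -
    obtain i where i: "i \<in> {1..m}" "q = p i" using q by blast
    have qb: "q \<in> beta Npos" using in_Jp[OF i(1)] i(2) Jp_subset_beta by blast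
    \<comment> \<open>The increments good for all reachable states at once; there are finitely many,
      so \<open>D\<close> is in \<open>q\<close>.\<close>
    define D where "D = {y \<in> Npos. \<forall>(xs, a, z)\<in>{(xs, a, z)\<in>R. length xs < m \<and> p (Suc (length xs)) = q}.
        \<forall>P\<in>T. int a + poly P (int z) + int y \<in> int ` next_set xs}"
    have "\<forall>\<^sub>F y in q. \<forall>s\<in>{(xs, a, z)\<in>R. length xs < m \<and> p (Suc (length xs)) = q}. \<forall>P\<in>T.
        (case s of (xs, a, z) \<Rightarrow> int a + poly P (int z) + int y \<in> int ` next_set xs)"
    proof (intro eventually_ball_finite ballI finT)
      show "finite {(xs, a, z)\<in>R. length xs < m \<and> p (Suc (length xs)) = q}"
        using finR by (rule finite_subset[rotated]) auto
      fix s P assume s: "s \<in> {(xs, a, z)\<in>R. length xs < m \<and> p (Suc (length xs)) = q}" "P \<in> T"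
      then obtain xs a z where s_eq: "s = (xs, a, z)" and "reach m p T \<Phi> K xs a z"
        and xs: "length xs < m" "p (Suc (length xs)) = q" by (auto simp: R_def)
      then have "admissible xs a z" using valid by (intro reach_admissible)
      from admissible_eventually[OF this xs(1) s(2)]
      show "\<forall>\<^sub>F y in q. (case s of (xs, a, z) \<Rightarrow> int a + poly P (int z) + int y \<in> int ` next_set xs)"
        unfolding s_eq xs(2) by simp
    qed
    with beta_eventually_mem[OF qb] have "\<forall>\<^sub>F y in q. y \<in> D"
      by eventually_elim (force simp: D_def)
    moreover have "D \<subseteq> Npos" by (auto simp: D_def)
    ultimately have JD: "Jp_set D" using in_Jp[OF i(1)] i(2) by (simp add: Jp_def)
    define diff where "diff z P = P \<circ>\<^sub>p [:int z, 1:] - [:poly P (int z):]" for z P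
    \<comment> \<open>Inserting \<open>0\<close> makes \<open>Ps\<close> nonempty by
      construction.\<close>
    define Ps where "Ps = insert 0 ((\<lambda>((xs, a, z), P). diff z P) ` (R \<times> T))"
    have "Ps \<in> Pf PP"
      using finR finT by (auto simp: Pf_iff Ps_def PP_def diff_def)
    have fin: "finite (\<Union>G\<in>{G\<in>Pf NN. G \<subset> K}. snd (\<Phi> G q))"
    proof (rule finite_UN_I)
      show "finite {G\<in>Pf NN. G \<subset> K}"
        by (rule finite_subset[of _ "Pow K"]) (use finK in auto)
      show "finite (snd (\<Phi> G q))" if "G \<in> {G\<in>Pf NN. G \<subset> K}" for G
        using valid_choiceD(2)[OF valid _ i(1), of G] that i(2) by (simp add: Pf_iff)
    qed
    \<comment> \<open>Index sets chosen beyond \<open>M\<close> come after those of all proper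
      subsets of \<open>K\<close>.\<close>
    then obtain M where M: "\<And>G t. G \<in> Pf NN \<Longrightarrow> G \<subset> K \<Longrightarrow> t \<in> snd (\<Phi> G q) \<Longrightarrow> t < M"
      unfolding finite_nat_set_iff_bounded by blast
    obtain c b where c: "c \<in> Npos" and b: "b \<in> Pf Npos" "\<forall>t\<in>b. M < t"
      and cb: "\<forall>P\<in>Ps. \<forall>f\<in>K. int c + poly P (int (\<Sum>t\<in>b. f t)) \<in> int ` D"
      using Jp_set_beyond[OF JD \<open>Ps \<in> Pf PP\<close> True] .
    have "snd (\<Phi> G q) \<lless> b" if G: "G \<in> Pf NN" "G \<subset> K" for G
    proof -
      have "snd (\<Phi> G q) \<in> Pf Npos" using valid_choiceD(2)[OF valid[OF G] G(1) i(1)] i(2) by simp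
      then have "Max (snd (\<Phi> G q)) < M" using M[OF G] by (simp add: Pf_iff)
      moreover have "M < Min b" using b by (simp add: Pf_iff)
      ultimately show ?thesis by (simp add: precedes_def)
    qed
    moreover have "int (a + c) + poly P (int (z + (\<Sum>t\<in>b. f t))) \<in> int ` next_set xs"
      if r: "reach m p T \<Phi> K xs a z" and xs: "length xs < m" "p (Suc (length xs)) = q"
        and P: "P \<in> T" and f: "f \<in> K" for xs a z P f
    proof -
      have R: "(xs, a, z) \<in> R" using r by (simp add: R_def)
      then have "diff z P \<in> Ps" using P by (force simp: Ps_def)
      then obtain y where y: "y \<in> D" "int c + poly (diff z P) (int (\<Sum>t\<in>b. f t)) = int y"
        using bspec[OF bspec[OF cb] f] by blast
      \<comment> \<open>\<open>y\<close> contains the increment of \<open>P\<close> from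
        \<open>z\<close>, so \<open>poly P (int z)\<close> cancels.\<close>
      have "int a + poly P (int z) + int y \<in> int ` next_set xs"
        using y(1) R xs P unfolding D_def by blast
      moreover have "int y = int c + poly P (int (z + (\<Sum>t\<in>b. f t))) - poly P (int z)"
        by (simp add: diff_def poly_pcompose flip: y(2))
      ultimately show ?thesis by (simp add: algebra_simps)
    qed
    ultimately show ?thesis using c b(1) by (intro exI[of _ "(c, b)"]) simp
  qed
  then have "\<forall>q\<in>p ` {1..m}. \<exists>b. fst b \<in> Npos \<and> snd b \<in> Pf Npos \<and>
     (\<forall>G\<in>Pf NN. G \<subset> K \<longrightarrow> snd (\<Phi> G q) \<lless> snd b) \<and>
     (\<forall>xs a z. reach m p T \<Phi> K xs a z \<longrightarrow> length xs < m \<longrightarrow> p (Suc (length xs)) = q \<longrightarrow>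
        (\<forall>P\<in>T. \<forall>f\<in>K. int (a + fst b) + poly P (int (z + (\<Sum>t\<in>snd b. f t))) \<in> int ` next_set xs))"
    by (rule ballI)
  from bchoice[OF this] show ?thesis unfolding valid_choice_def by (elim exE) (rule exI, rule impI)
qed (simp add: valid_choice_def)

text \<open>Recursion on cardinality. Infinite sets have \<open>card\<close> equal to
  \<open>0\<close>, which is harmless because validity is vacuous there.\<close>

lemma ex_valid: "\<exists>\<Phi>. \<forall>K. valid_choice \<Phi> K (\<Phi> K)"
proof (rule dependent_wf_choice)
  show "wf (measure (\<lambda>G :: (nat \<Rightarrow> nat) set. card G))" by simp
next
  fix \<Phi> \<Psi> :: "(nat \<Rightarrow> nat) set \<Rightarrow> choice" and K r
  assume eq: "\<And>G. (G, K) \<in> measure card \<Longrightarrow> \<Phi> G = \<Psi> G"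
  show "valid_choice \<Phi> K r = valid_choice \<Psi> K r"
  proof (cases "K \<in> Pf NN")
    case True
    then have eq': "\<Phi> G = \<Psi> G" if "G \<subset> K" for G
      using eq[of G] that psubset_card_mono[of K G] by (simp add: Pf_iff)
    have "reach m p T \<Phi> K xs a z \<longleftrightarrow> reach m p T \<Psi> K xs a z" for xs a z
      using reach_cong[of m p T \<Phi> K xs a z \<Psi>] reach_cong[of m p T \<Psi> K xs a z \<Phi>] eq' by auto
    then show ?thesis unfolding valid_choice_def using eq' by simp
  qed (simp add: valid_choice_def)
next
  fix K and \<Phi> :: "(nat \<Rightarrow> nat) set \<Rightarrow> choice"
  assume v: "\<And>G. (G, K) \<in> measure card \<Longrightarrow> valid_choice \<Phi> G (\<Phi> G)"
  show "\<exists>r. valid_choice \<Phi> K r"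
  proof (cases "K \<in> Pf NN")
    case True
    then have "valid_choice \<Phi> G (\<Phi> G)" if "G \<subset> K" for G
      using v[of G] that psubset_card_mono[of K G] by (simp add: Pf_iff)
    then show ?thesis by (rule ex_valid_choice)
  qed (simp add: valid_choice_def)
qed

text \<open>Blocks are completed one after another; the state is reached over every
  \<open>G i\<close> with \<open>i\<close> beyond the last completed block, so that the next block
  can start there.\<close>

lemma reach_blocks:
  fixes \<Phi> :: "(nat \<Rightarrow> nat) set \<Rightarrow> choice" and P :: "nat \<Rightarrow> int poly"
    and f :: "nat \<Rightarrow> nat \<Rightarrow> nat" and G :: "nat \<Rightarrow> (nat \<Rightarrow> nat) set" and \<beta> :: "nat \<Rightarrow> nat set"
  defines "val \<equiv> \<lambda>j. block_value (\<lambda>K. fst (\<Phi> K (p j))) (\<lambda>K. snd (\<Phi> K (p j))) G f (P j) (\<beta> j)"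
  assumes \<Phi>: "\<And>K. valid_choice \<Phi> K (\<Phi> K)"
    and G: "\<And>i. i \<in> Npos \<Longrightarrow> G i \<in> Pf NN" "\<And>i. i \<in> Npos \<Longrightarrow> G i \<subset> G (Suc i)"
    and \<beta>: "\<And>j. j \<in> {1..m} \<Longrightarrow> \<beta> j \<in> Pf Npos" "\<And>j. j \<in> {1..<m} \<Longrightarrow> \<beta> j \<lless> \<beta> (Suc j)"
    and f: "\<And>i. i \<in> Npos \<Longrightarrow> f i \<in> G i"
    and P: "\<And>j. j \<in> {1..m} \<Longrightarrow> P j \<in> T"
  shows "j \<le> m \<Longrightarrow> (\<forall>j'\<in>{1..j}. 0 < val j') \<and>
    (\<forall>i\<in>Npos. j = 0 \<or> Max (\<beta> j) < i \<longrightarrow>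
       reach m p T \<Phi> (G i) (map (\<lambda>j. nat (val j)) [1..<Suc j]) 0 0)"
proof (induction j)
  case 0
  show ?case by (simp add: reach.start)
next
  case (Suc j)
  define xs where "xs = map (\<lambda>j. nat (val j)) [1..<Suc j]"
  define q where "q = p (Suc j)"
  have len: "length xs = j" by (simp add: xs_def)
  have j: "Suc j \<in> {1..m}" using Suc.prems by simp
  have b: "finite (\<beta> (Suc j))" "\<beta> (Suc j) \<noteq> {}" "\<beta> (Suc j) \<subseteq> Npos"
    using \<beta>(1)[OF j] by (auto simp: Pf_iff)
  have mono: "G i \<subset> G i'" if "i \<in> Npos" "i < i'" for i i'
    \<comment> \<open>The index is shifted because the chain is controlled on positive indices
      only.\<close>
    using lift_Suc_mono_less[of "\<lambda>n. G (Suc n)" "i - 1" "i' - 1"] G(2) that by simp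
  \<comment> \<open>Elements of the block are added in increasing order, so each addition moves up
    the chain.\<close>
  have partial: "C \<subseteq> \<beta> (Suc j) \<longrightarrow> (\<forall>i\<in>Npos. (\<forall>c\<in>C. c < i) \<longrightarrow> j = 0 \<or> Max (\<beta> j) < i \<longrightarrow>
      reach m p T \<Phi> (G i) xs (\<Sum>c\<in>C. fst (\<Phi> (G c) q)) (\<Sum>c\<in>C. \<Sum>t\<in>snd (\<Phi> (G c) q). f c t))"
    if "finite C" for C
    using that
  proof (induction C rule: finite_linorder_max_induct)
    case empty
    then show ?case using Suc by (simp add: xs_def del: upt_Suc)
  next
    case (insert c C)
    show ?case
    proof (intro impI ballI)
      fix i assume sub: "insert c C \<subseteq> \<beta> (Suc j)" and i: "i \<in> Npos" "\<forall>c\<in>insert c C. c < i"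
      have c: "c \<in> Npos" "c \<in> \<beta> (Suc j)" using sub b by auto
      have "j = 0 \<or> Max (\<beta> j) < c"
      proof (cases "j = 0")
        case False
        then have "\<beta> j \<lless> \<beta> (Suc j)" using Suc.prems by (intro \<beta>(2)) simp
        then have "Max (\<beta> j) < Min (\<beta> (Suc j))" by (simp add: precedes_def)
        also have "\<dots> \<le> c" using b c by (intro Min_le)
        finally show ?thesis ..
      qed simp
      then have "reach m p T \<Phi> (G c) xs (\<Sum>c\<in>C. fst (\<Phi> (G c) q))
          (\<Sum>c\<in>C. \<Sum>t\<in>snd (\<Phi> (G c) q). f c t)"
        using insert.IH insert.hyps sub c by blast
      moreover have "G c \<subset> G i" using mono[of c i] c i by simp
      moreover have "length xs < m" using Suc.prems len by simp
      ultimately have "reach m p T \<Phi> (G i) xs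
          ((\<Sum>c\<in>C. fst (\<Phi> (G c) q)) + fst (\<Phi> (G c) (p (Suc (length xs)))))
          ((\<Sum>c\<in>C. \<Sum>t\<in>snd (\<Phi> (G c) q). f c t) + (\<Sum>t\<in>snd (\<Phi> (G c) (p (Suc (length xs)))). f c t))"
        using G(1)[OF c(1)] f[OF c(1)] by (intro reach.add)
      moreover have "c \<notin> C" using insert.hyps by blast
      ultimately show "reach m p T \<Phi> (G i) xs (\<Sum>c\<in>insert c C. fst (\<Phi> (G c) q))
          (\<Sum>c\<in>insert c C. \<Sum>t\<in>snd (\<Phi> (G c) q). f c t)"
        using insert.hyps by (simp add: len q_def add.commute)
    qed
  qed
  define a where "a = (\<Sum>c\<in>\<beta> (Suc j). fst (\<Phi> (G c) q))"
  define z where "z = (\<Sum>c\<in>\<beta> (Suc j). \<Sum>t\<in>snd (\<Phi> (G c) q). f c t)"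
  have val: "val (Suc j) = int a + poly (P (Suc j)) (int z)"
    by (simp add: val_def block_value_def a_def z_def q_def)
  have a_pos: "0 < a"
    unfolding a_def
  proof (rule sum_pos[OF b(1,2)])
    fix c assume "c \<in> \<beta> (Suc j)"
    then have "c \<in> Npos" using b by blast
    from valid_choiceD(1)[OF \<Phi> G(1)[OF this] j] show "0 < fst (\<Phi> (G c) q)" by (simp add: q_def)
  qed
  have reach: "reach m p T \<Phi> (G i) xs a z" if i: "i \<in> Npos" "Max (\<beta> (Suc j)) < i" for i
  proof -
    have less: "c < i" if "c \<in> \<beta> (Suc j)" for c using that i b by simp
    have "j = 0 \<or> Max (\<beta> j) < i"
    proof (cases "j = 0")
      case False
      then have "\<beta> j \<lless> \<beta> (Suc j)" using Suc.prems by (intro \<beta>(2)) simp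
      then have "Max (\<beta> j) < Min (\<beta> (Suc j))" by (simp add: precedes_def)
      also have "\<dots> < i" using less b Min_in by blast
      finally show ?thesis ..
    qed simp
    then show ?thesis using partial[OF b(1)] i less unfolding a_def z_def by blast
  qed
  have "admissible xs a z"
    by (rule reach_admissible[OF reach[of "Suc (Max (\<beta> (Suc j)))"] \<Phi>]) auto
  \<comment> \<open>Membership in \<open>next_set\<close> gives positivity, so \<open>nat\<close>
    loses nothing.\<close>
  then have "val (Suc j) \<in> int ` next_set xs" using a_pos P[OF j] by (simp add: admissible_def val)
  moreover have "next_set xs \<subseteq> Npos" using star_subset unfolding next_set_def by blast
  ultimately have "0 < val (Suc j)" by auto
  then have "\<forall>j'\<in>{1..Suc j}. 0 < val j'" using Suc by (simp add: atLeastAtMostSuc_conv)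
  moreover have "reach m p T \<Phi> (G i) (map (\<lambda>j. nat (val j)) [1..<Suc (Suc j)]) 0 0"
    if "i \<in> Npos" "Max (\<beta> (Suc j)) < i" for i
  proof -
    have "reach m p T \<Phi> (G i) (xs @ [nat (val (Suc j))]) 0 0"
      unfolding val using reach[OF that] a_pos P[OF j] Suc.prems len by (intro reach.close) auto
    then show ?thesis by (simp add: xs_def)
  qed
  ultimately show ?case by simp
qed

end

theorem corollary1p34:
  fixes m :: nat and h :: "nat list \<Rightarrow> nat" and p :: "nat \<Rightarrow> nat filter"
    and S :: "nat filter set" and A :: "nat set" and T :: "int poly set"
  assumes "m \<ge> 1"
    and "polynomial_map_no_const m h"
    and "S = minimal_idempotents \<or> S = Jp_idempotents"
    and "\<forall>i\<in>{1..m}. p i \<in> S"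
    and "A \<subseteq> Npos"
    and "\<forall>\<^sub>F n in filtermap h (tensor p m). n \<in> A"
    and "T \<in> Pf PP"
  shows "\<exists>(\<alpha> :: nat \<Rightarrow> (nat \<Rightarrow> nat) set \<Rightarrow> nat) (H :: nat \<Rightarrow> (nat \<Rightarrow> nat) set \<Rightarrow> nat set).
    (\<forall>i\<in>{1..m}. \<alpha> i \<in> Pf NN \<rightarrow> Npos \<and> H i \<in> Pf NN \<rightarrow> Pf Npos) \<and>
    (\<forall>i\<in>{1..m}. \<forall>G\<in>Pf NN. \<forall>K\<in>Pf NN. G \<subset> K \<longrightarrow> H i G \<lless> H i K) \<and>
    (\<forall>G \<beta> f P.
       (\<forall>i\<in>Npos. G i \<in> Pf NN \<and> G i \<subset> G (Suc i)) \<longrightarrow>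
       (\<forall>j\<in>{1..m}. \<beta> j \<in> Pf Npos) \<longrightarrow>
       (\<forall>j\<in>{1..<m}. \<beta> j \<lless> \<beta> (Suc j)) \<longrightarrow>
       (\<forall>i\<in>Npos. f i \<in> G i) \<longrightarrow>
       (\<forall>j\<in>{1..m}. P j \<in> T) \<longrightarrow>
       (\<forall>j\<in>{1..m}. 0 < block_value (\<alpha> j) (H j) G f (P j) (\<beta> j)) \<and>
       h (map (\<lambda>j. nat (block_value (\<alpha> j) (H j) G f (P j) (\<beta> j))) [1..<Suc m]) \<in> A) \<and>
    ((\<exists>q\<in>S. \<forall>i\<in>{1..m}. p i = q) \<longrightarrow>
       (\<exists>\<alpha>\<^sub>0 H\<^sub>0. \<forall>i\<in>{1..m}. \<alpha> i = \<alpha>\<^sub>0 \<and> H i = H\<^sub>0))"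
proof -
  have "S \<subseteq> Jp_idempotents" using assms(3) minimal_idempotents_subset by blast
  moreover have "\<forall>\<^sub>F xs in tensor p m. xs \<in> {xs. h xs \<in> A}"
    using assms(6) by (simp add: eventually_filtermap)
  ultimately interpret tensor_member m p "{xs. h xs \<in> A}" T
    using assms(4,7) by unfold_locales auto
  obtain \<Phi> where \<Phi>: "\<And>K. valid_choice \<Phi> K (\<Phi> K)" using ex_valid by blast
  \<comment> \<open>The index \<open>i\<close> enters only through \<open>p i\<close>, which yields
    the last claim.\<close>
  define \<alpha> where "\<alpha> i K = fst (\<Phi> K (p i))" for i K
  define H where "H i K = snd (\<Phi> K (p i))" for i K
  note valid = valid_choiceD[OF \<Phi>]
  show ?thesis
  proof (intro exI[of _ \<alpha>] exI[of _ H] conjI ballI allI impI)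
    fix i assume i: "i \<in> {1..m}"
    show "\<alpha> i \<in> Pf NN \<rightarrow> Npos" "H i \<in> Pf NN \<rightarrow> Pf Npos"
      using valid(1,2)[OF _ i] by (simp_all add: \<alpha>_def H_def Pi_iff)
    fix G K assume "G \<in> Pf NN" "K \<in> Pf NN" "G \<subset> K"
    then show "H i G \<lless> H i K" using valid(3)[OF _ i] by (simp add: H_def)
  next
    fix G \<beta> and f :: "nat \<Rightarrow> nat \<Rightarrow> nat" and P :: "nat \<Rightarrow> int poly"
    assume G: "\<forall>i\<in>Npos. G i \<in> Pf NN \<and> G i \<subset> G (Suc i)"
      and \<beta>: "\<forall>j\<in>{1..m}. \<beta> j \<in> Pf Npos" "\<forall>j\<in>{1..<m}. \<beta> j \<lless> \<beta> (Suc j)"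
      and f: "\<forall>i\<in>Npos. f i \<in> G i" and P: "\<forall>j\<in>{1..m}. P j \<in> T"
    define val where "val j = block_value (\<alpha> j) (H j) G f (P j) (\<beta> j)" for j
    have "(\<forall>j\<in>{1..m}. 0 < val j) \<and> (\<forall>i\<in>Npos. m = 0 \<or> Max (\<beta> m) < i \<longrightarrow>
        reach m p T \<Phi> (G i) (map (\<lambda>j. nat (val j)) [1..<Suc m]) 0 0)"
      unfolding val_def \<alpha>_def H_def by (rule reach_blocks) (use \<Phi> G \<beta> f P in auto)
    then have pos: "\<forall>j\<in>{1..m}. 0 < val j"
      and r: "reach m p T \<Phi> (G (Suc (Max (\<beta> m)))) (map (\<lambda>j. nat (val j)) [1..<Suc m]) 0 0"
      by auto
    show "0 < block_value (\<alpha> j) (H j) G f (P j) (\<beta> j)" if "j \<in> {1..m}" for j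
      using pos that by (simp add: val_def)
    \<comment> \<open>With \<open>m\<close> blocks complete no quantifier remains, and
      \<open>extendable\<close> is membership in the given set.\<close>
    have "admissible (map (\<lambda>j. nat (val j)) [1..<Suc m]) 0 0"
      using r by (rule reach_admissible) (rule \<Phi>)
    then show "h (map (\<lambda>j. nat (block_value (\<alpha> j) (H j) G f (P j) (\<beta> j))) [1..<Suc m]) \<in> A"
      by (simp add: admissible_def val_def del: upt_Suc)
  next
    assume "\<exists>q\<in>S. \<forall>i\<in>{1..m}. p i = q"
    then obtain q where "\<forall>i\<in>{1..m}. p i = q" by blast
    then show "\<exists>\<alpha>\<^sub>0 H\<^sub>0. \<forall>i\<in>{1..m}. \<alpha> i = \<alpha>\<^sub>0 \<and> H i = H\<^sub>0"
      by (intro exI[of _ "\<lambda>K. fst (\<Phi> K q)"] exI[of _ "\<lambda>K. snd (\<Phi> K q)"])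
        (auto simp: \<alpha>_def H_def)
  qed
qed

end
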